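(* For every positive integer $n$, the map $\chi:\mathfrak{S}_n\to\mathfrak{S}_n$ defined in the context (the "first variant") is injective, and therefore a bijection.
   Context: Notation. $[n]=\{1,\dots,n\}$; permutations are in one-line notation. A run of $\pi\in\mathfrak{S}_n$ is a maximal consecutive decreasing subsequence of its one-line notation; its largest element is a run top and its smallest element a run bottom. $RT$ and $RB$ are the sets of run tops and run bottoms of $\pi$. The multiset of descent views of $\pi$ contains each $v=\pi(j)$ with multiplicity the number of $i\in[n-1]$ such that $\pi(i)>v>\pi(i+1)$ and the run containing $\pi(i),\pi(i+1)$ has a smaller run bottom than the run containing $v$. $\sigma_e=\chi_e(\pi):[n]\setminus RT\to[n]\setminus RB$ denotes the unique bijection whose multiset of inversion bottoms $\{\{\sigma_e(j)\mid i<j,\ \sigma_e(i)>\sigma_e(j)\}\}$ ($i,j$ in the domain) equals the multiset of descent views of $\pi$ which are not run bottoms; it exists and satisfies $\sigma_e(i)>i$ for all $i\in[n]\setminus RT$. For a partial permutation $f$ (an injective map $S\to[n]$ with $S\subseteq[n]$) and $c\in[n]$ not contained in a cycle of $f$, the iterated preimage $f^*(c)$ is the element $s$ such that $f^k(s)=c$ with $k\ge0$ maximal; in particular $f^*(c)=c$ if $c$ is not in the image of $f$. Definition of $\chi$. Given $\pi$, start with the partial permutation $\sigma=\sigma_e$ and with the sequence of runs of $\pi$ in the order in which they occur in $\pi$. The runs remain separate entities even after other runs are removed. Let $\rho:RB\to RT$ map each run bottom of $\pi$ to the run top of the same run. At the beginning of each iteration let $\tau=\sigma^*\circ\rho$ (with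 the current $\sigma$), restricted to the run bottoms of the runs remaining at that time. While runs remain, iterate: (1) Let $t$ be the smallest run top among the remaining runs. (2) Remove the run containing $t$ from the sequence. (3) If $t$ was the first element of what remained of $\pi$ (i.e. its run was the first in the sequence before removal), set $\sigma(t)=\sigma^*(t)$. (4) Otherwise, let $a$ be the run bottom left of $t$ (the run bottom of the run immediately preceding the run of $t$ in the remaining sequence), let $k\ge1$ be minimal such that $\tau^k(a)<t$, and set $\sigma(t)=\tau^k(a)$. This procedure is well defined. After all runs have been removed, $\sigma$ is a permutation of $[n]$, and $\chi(\pi)=\sigma$. *)

theory Defs
  imports Main "HOL-Library.Multiset" "HOL-Combinatorics.Permutations"
begin

text \<open>
  A permutation of \<open>[n]\<close> is a function \<open>\<pi>\<close> with \<open>\<pi> permutes {1..n}\<close>; a partial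
  permutation is a map \<open>nat \<rightharpoonup> nat\<close>.
\<close>

definition one_line :: "nat \<Rightarrow> (nat \<Rightarrow> nat) \<Rightarrow> nat list" where
  "one_line n \<pi> = map \<pi> [1..<Suc n]"

text \<open>
  Splitting a word into its maximal consecutive decreasing subsequences, in order of
  occurrence.  For distinct letters the run top is the head and the run bottom the last
  entry of a run.
\<close>

fun dec_runs :: "nat list \<Rightarrow> nat list list" where
  "dec_runs [] = []"
| "dec_runs [x] = [[x]]"
| "dec_runs (x # y # ys) =
     (if x > y then (x # hd (dec_runs (y # ys))) # tl (dec_runs (y # ys))
      else [x] # dec_runs (y # ys))"

definition runs :: "nat \<Rightarrow> (nat \<Rightarrow> nat) \<Rightarrow> nat list list" where
  "runs n \<pi> = dec_runs (one_line n \<pi>)"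

definition run_tops :: "nat \<Rightarrow> (nat \<Rightarrow> nat) \<Rightarrow> nat set" where
  "run_tops n \<pi> = hd ` set (runs n \<pi>)"

definition run_bottoms :: "nat \<Rightarrow> (nat \<Rightarrow> nat) \<Rightarrow> nat set" where
  "run_bottoms n \<pi> = last ` set (runs n \<pi>)"

definition run_of :: "nat \<Rightarrow> (nat \<Rightarrow> nat) \<Rightarrow> nat \<Rightarrow> nat list" where
  "run_of n \<pi> v = (THE r. r \<in> set (runs n \<pi>) \<and> v \<in> set r)"

definition descent_views :: "nat \<Rightarrow> (nat \<Rightarrow> nat) \<Rightarrow> nat multiset" where
  "descent_views n \<pi> =
     {# \<pi> j. (i, j) \<in># mset_set {(i, j). i \<in> {1..<n} \<and> j \<in> {1..n} \<and>
          \<pi> i > \<pi> j \<and> \<pi> j > \<pi> (Suc i) \<and>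
          last (run_of n \<pi> (\<pi> i)) < last (run_of n \<pi> (\<pi> j))} #}"

definition inversion_bottoms :: "(nat \<rightharpoonup> nat) \<Rightarrow> nat multiset" where
  "inversion_bottoms \<sigma> =
     {# the (\<sigma> j). (i, j) \<in># mset_set {(i, j). i \<in> dom \<sigma> \<and> j \<in> dom \<sigma> \<and>
          i < j \<and> the (\<sigma> i) > the (\<sigma> j)} #}"

definition chi_e :: "nat \<Rightarrow> (nat \<Rightarrow> nat) \<Rightarrow> (nat \<rightharpoonup> nat)" where
  "chi_e n \<pi> = (THE \<sigma>. dom \<sigma> = {1..n} - run_tops n \<pi> \<and>
     bij_betw (\<lambda>i. the (\<sigma> i)) ({1..n} - run_tops n \<pi>) ({1..n} - run_bottoms n \<pi>) \<and>
     inversion_bottoms \<sigma> = filter_mset (\<lambda>v. v \<notin> run_bottoms n \<pi>) (descent_views n \<pi>))"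

primrec map_pow :: "('a \<rightharpoonup> 'a) \<Rightarrow> nat \<Rightarrow> ('a \<rightharpoonup> 'a)" where
  "map_pow f 0 = Some"
| "map_pow f (Suc k) = f \<circ>\<^sub>m map_pow f k"

text \<open>
  The iterated preimage \<open>f\<^sup>*(c)\<close>; meaningful only when \<open>f\<close> is injective with finite domain
  and \<open>c\<close> does not lie on a cycle of \<open>f\<close>.
\<close>

definition iter_preimage :: "('a \<rightharpoonup> 'a) \<Rightarrow> 'a \<Rightarrow> 'a" where
  "iter_preimage f c = (THE s. \<exists>k. map_pow f k s = Some c \<and>
     (\<forall>k' s'. map_pow f k' s' = Some c \<longrightarrow> k' \<le> k))"

definition run_rho :: "nat \<Rightarrow> (nat \<Rightarrow> nat) \<Rightarrow> nat \<Rightarrow> nat" where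
  "run_rho n \<pi> b = hd (THE r. r \<in> set (runs n \<pi>) \<and> last r = b)"

text \<open>
  The map \<open>\<tau> = \<sigma>\<^sup>* \<circ> \<rho>\<close> with domain restricted to the bottoms of the remaining runs \<open>rs\<close>.
  Its values need not be bottoms of remaining runs, so it is iterated as a partial map.
\<close>

definition chi_tau ::
    "(nat \<Rightarrow> nat) \<Rightarrow> nat list list \<Rightarrow> (nat \<rightharpoonup> nat) \<Rightarrow> (nat \<rightharpoonup> nat)" where
  "chi_tau \<rho> rs \<sigma> = (\<lambda>b. if b \<in> last ` set rs then Some (iter_preimage \<sigma> (\<rho> b)) else None)"

text \<open>
  The new value \<open>\<sigma>(t)\<close> in one iteration; \<open>rs\<close> are the runs remaining at its beginning
  (including the run with top \<open>t\<close>), and \<open>p\<close> is the position of that run in \<open>rs\<close>.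
\<close>

definition chi_value ::
    "(nat \<Rightarrow> nat) \<Rightarrow> nat list list \<Rightarrow> (nat \<rightharpoonup> nat) \<Rightarrow> nat \<Rightarrow> nat option" where
  "chi_value \<rho> rs \<sigma> t =
     (let p = (THE p. p < length rs \<and> hd (rs ! p) = t) in
      if p = 0 then Some (iter_preimage \<sigma> t)
      else
        let a = last (rs ! (p - 1));
            \<tau> = chi_tau \<rho> rs \<sigma>;
            k = (LEAST k. k \<ge> 1 \<and> (\<exists>x. map_pow \<tau> k a = Some x \<and> x < t))
        in map_pow \<tau> k a)"

function chi_loop ::
    "(nat \<Rightarrow> nat) \<Rightarrow> nat list list \<Rightarrow> (nat \<rightharpoonup> nat) \<Rightarrow> (nat \<rightharpoonup> nat)" where
  "chi_loop \<rho> rs \<sigma> =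
     (if rs = [] then \<sigma>
      else let t = Min (hd ` set rs)
           in chi_loop \<rho> (filter (\<lambda>r. hd r \<noteq> t) rs) (\<sigma>(t := chi_value \<rho> rs \<sigma> t)))"
  by pat_completeness auto

termination
proof (relation "measure (\<lambda>(\<rho>, rs, \<sigma>). length rs)", goal_cases)
  case 1
  show ?case by simp
next
  case (2 \<rho> rs \<sigma> t)
  have "t \<in> hd ` set rs"
    using 2 by simp
  then obtain r where "r \<in> set rs" "hd r = t"
    by blast
  then show ?case
    by (auto intro: length_filter_less)
qed

declare chi_loop.simps [simp del]

text \<open>
  The final \<open>\<sigma>\<close> has domain \<open>[n]\<close>; it is extended by the identity outside \<open>[n]\<close>, as
  required by \<open>permutes\<close>.
\<close>

definition chi :: "nat \<Rightarrow> (nat \<Rightarrow> nat) \<Rightarrow> (nat \<Rightarrow> nat)" where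
  "chi n \<pi> = (\<lambda>x. case chi_loop (run_rho n \<pi>) (runs n \<pi>) (chi_e n \<pi>) x of
     None \<Rightarrow> x | Some y \<Rightarrow> y)"

end

theory Submission
  imports Defs
begin

text \<open>
  The map \<^term>\<open>chi n\<close> can be undone in three stages.

  First, every value added by the loop satisfies \<open>\<sigma>(t) \<le> t\<close>, while \<^term>\<open>chi_e n \<pi>\<close> has
  only excedances. Hence the run tops of \<open>\<pi>\<close> are the non-excedances of its image, and the
  restriction of the image to the other letters is \<^term>\<open>chi_e n \<pi>\<close>, whose values are the
  letters that are not run bottoms. The inversion bottoms of this restriction are the descent
  views that are not run bottoms.

  Second, these data determine the runs as sets of letters (\<open>bottom_map_determined\<close>): the
  number of descent views of a letter \<open>v\<close> other than a run bottom is the rank of its run, ordered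
  by bottoms, among the runs that are open at \<open>v\<close>, and so the letters can be distributed to the
  runs from \<open>1\<close> upwards.
  The same argument, with positions instead of runs, shows that a bijection is determined by its
  inversion bottoms and that \<^term>\<open>chi_e n \<pi>\<close> exists (\<open>placement_unique\<close>,
  \<open>placement_exists\<close>).

  Third, the loop records the order of the runs (\<open>loop_inject\<close>). At each step the map
  \<open>\<tau>\<close> and the set of remaining runs are known, and only the place of the removed run is not. Let
  \<open>t\<close> be its top. A remaining run always ends below the top of the next one, so the bottom \<open>a\<close>
  left of \<open>t\<close> is below \<open>t\<close>. Since \<open>\<tau>\<close> is injective and \<open>\<sigma>(t)\<close> is the first value below \<open>t\<close>
  after \<open>a\<close> in its orbit, \<open>a\<close> is in turn the first bottom below \<open>t\<close> on the way back from
  \<open>\<sigma>(t)\<close>. The case of a removed run in first place cannot be confused with this one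
  (\<open>value_first_ne_later\<close>). The removed run can thus be put back into the sequence
  of the other runs.
\<close>

section \<open>Bijections with prescribed inversion bottoms\<close>

lemma rank_less:
  fixes x y :: "'a::linorder"
  assumes "finite P" "x \<in> P" "x < y"
  shows "card {p \<in> P. p < x} < card {p \<in> P. p < y}"
proof -
  have "{p \<in> P. p < x} \<subset> {p \<in> P. p < y}"
    using assms by (auto intro: less_trans)
  then show ?thesis
    using assms(1) by (intro psubset_card_mono) auto
qed

lemma rank_inject:
  fixes x y :: "'a::linorder"
  assumes "finite P" "x \<in> P" "y \<in> P" "card {p \<in> P. p < x} = card {p \<in> P. p < y}"
  shows "x = y"
  using rank_less[OF assms(1,2), of y] rank_less[OF assms(1,3), of x] assms(4)
  by (metis less_irrefl not_less_iff_gr_or_eq)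

lemma rank_attained:
  fixes P :: "'a::linorder set"
  assumes "finite P" "k < card P"
  shows "\<exists>x\<in>P. card {p \<in> P. p < x} = k"
proof -
  let ?rank = "\<lambda>x. card {p \<in> P. p < x}"
  have "inj_on ?rank P"
    using rank_inject[OF assms(1)] by (auto intro: inj_onI)
  then have "card (?rank ` P) = card {..<card P}"
    by (simp add: card_image)
  moreover have "?rank ` P \<subseteq> {..<card P}"
    using assms(1) by (auto intro!: psubset_card_mono)
  ultimately have "?rank ` P = {..<card P}"
    by (simp add: card_subset_eq)
  then have "k \<in> ?rank ` P"
    using assms(2) by simp
  then show ?thesis
    by blast
qed

text \<open>
  A bijection is handled through its inverse \<open>g\<close>, which sends a value to its position.
  The number of inversions with bottom \<open>v\<close> is then the number of larger values placed to
  the left of \<open>v\<close>.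
\<close>

definition left_larger :: "nat set \<Rightarrow> (nat \<Rightarrow> nat) \<Rightarrow> nat \<Rightarrow> nat set" where
  "left_larger E g v = {w \<in> E. v < w \<and> g w < g v}"

text \<open>
  Place the values in increasing order: among the positions still vacant when \<open>v\<close> is placed,
  those left of \<open>v\<close> are exactly the ones that later receive larger values.  Hence \<open>v\<close> must
  take the vacant position with \<open>c v\<close> vacant positions to its left, and it can do so as soon
  as \<open>c v\<close> is smaller than the number of vacant positions.
\<close>

lemma placement_exists:
  fixes D E :: "nat set"
  assumes "finite D" "finite E" "card D = card E"
    and "\<And>v. v \<in> E \<Longrightarrow> c v < card {w \<in> E. v \<le> w}"
  shows "\<exists>g. bij_betw g E D \<and> (\<forall>v\<in>E. card (left_larger E g v) = c v)"
  using assms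
proof (induction "card E" arbitrary: D E)
  case 0
  then have "E = {}" "D = {}"
    by auto
  then show ?case
    by (auto simp: bij_betw_def)
next
  case (Suc k)
  have "E \<noteq> {}"
    using Suc.hyps(2) by auto
  define m where "m = Min E"
  have m: "m \<in> E" "\<And>w. w \<in> E \<Longrightarrow> m \<le> w"
    using \<open>finite E\<close> \<open>E \<noteq> {}\<close> by (auto simp: m_def)
  have "{w \<in> E. m \<le> w} = E"
    using m by auto
  then have "c m < card D"
    using Suc.prems(3,4) m(1) by metis
  then obtain p where p: "p \<in> D" "card {d \<in> D. d < p} = c m"
    using rank_attained[OF \<open>finite D\<close>] by blast
  have "c v < card {w \<in> E - {m}. v \<le> w}" if "v \<in> E - {m}" for v
  proof -
    have "{w \<in> E - {m}. v \<le> w} = {w \<in> E. v \<le> w}"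
      using that m(2)[of v] by auto
    then show ?thesis
      using Suc.prems(4) that by auto
  qed
  moreover have "k = card (E - {m})" "card (D - {p}) = card (E - {m})"
    using Suc m p by auto
  ultimately obtain g where g: "bij_betw g (E - {m}) (D - {p})"
      "\<And>v. v \<in> E - {m} \<Longrightarrow> card (left_larger (E - {m}) g v) = c v"
    using Suc.hyps(1)[of "E - {m}" "D - {p}"] Suc.prems(1,2) by auto
  define h where "h = g(m := p)"
  have "bij_betw h (E - {m} \<union> {m}) (D - {p} \<union> {p})"
  proof (rule bij_betw_combine)
    show "bij_betw h (E - {m}) (D - {p})"
      using g(1) by (rule bij_betw_cong[THEN iffD1, rotated]) (auto simp: h_def)
  qed (auto simp: h_def bij_betw_def)
  then have "bij_betw h E D"
    using m(1) p(1) by (simp add: insert_absorb)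
  moreover have "card (left_larger E h v) = c v" if "v \<in> E" for v
  proof (cases "v = m")
    case True
    have "h ` left_larger E h m = {d \<in> D. d < p}"
    proof
      show "h ` left_larger E h m \<subseteq> {d \<in> D. d < p}"
        using g(1) by (auto simp: left_larger_def h_def bij_betw_def)
      show "{d \<in> D. d < p} \<subseteq> h ` left_larger E h m"
      proof
        fix d assume d: "d \<in> {d \<in> D. d < p}"
        then have "d \<in> g ` (E - {m})"
          using g(1) by (auto simp: bij_betw_def)
        then obtain w where w: "w \<in> E" "w \<noteq> m" "d = g w"
          by auto
        then have "m < w"
          using m(2)[of w] by simp
        then have "w \<in> left_larger E h m" "d = h w"
          using w d by (auto simp: left_larger_def h_def)
        then show "d \<in> h ` left_larger E h m"
          by blast
      qed
    qed
    moreover have "inj_on h (left_larger E h m)"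
      using \<open>bij_betw h E D\<close>
      by (auto simp: bij_betw_def left_larger_def intro: inj_on_subset)
    ultimately show ?thesis
      using p(2) True by (metis card_image)
  next
    case False
    then have "left_larger E h v = left_larger (E - {m}) g v"
      using that m(2)[of v] by (auto simp: left_larger_def h_def)
    then show ?thesis
      using g(2) that False by simp
  qed
  ultimately show ?case
    by blast
qed

lemma placement_unique:
  fixes g g' :: "nat \<Rightarrow> nat"
  assumes "finite E" "bij_betw g E D" "bij_betw g' E D"
    and "\<And>v. v \<in> E \<Longrightarrow> card (left_larger E g v) = card (left_larger E g' v)"
    and "v \<in> E"
  shows "g v = g' v"
  using \<open>v \<in> E\<close>
proof (induction v rule: less_induct)
  case (less v)
  define P where "P = D - g ` {w \<in> E. w < v}"
  have P': "P = D - g' ` {w \<in> E. w < v}"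
    using less.IH by (auto simp: P_def)
  have rank: "card {p \<in> P. p < f v} = card (left_larger E f v) \<and> f v \<in> P"
    if f: "bij_betw f E D" and Pf: "P = D - f ` {w \<in> E. w < v}" for f
  proof -
    have "P = f ` {w \<in> E. v \<le> w}"
    proof -
      have "f ` E = D" "inj_on f E"
        using f by (auto simp: bij_betw_def)
      then have "P = f ` (E - {w \<in> E. w < v})"
        unfolding Pf by (subst inj_on_image_set_diff[of f E]) auto
      also have "E - {w \<in> E. w < v} = {w \<in> E. v \<le> w}"
        by auto
      finally show ?thesis .
    qed
    then have "{p \<in> P. p < f v} = f ` left_larger E f v"
      by (auto simp: left_larger_def le_less)
    moreover have "inj_on f (left_larger E f v)"
      using f by (auto simp: bij_betw_def left_larger_def intro: inj_on_subset)
    ultimately show ?thesis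
      using \<open>P = f ` _\<close> less.prems by (auto simp: card_image)
  qed
  have "finite P"
    using assms(1,2) by (auto simp: P_def bij_betw_def)
  moreover have "card {p \<in> P. p < g v} = card {p \<in> P. p < g' v}"
    using rank[OF assms(2) P_def] rank[OF assms(3) P'] assms(4)[OF less.prems] by simp
  ultimately show ?case
    using rank[OF assms(2) P_def] rank[OF assms(3) P'] by (blast intro: rank_inject)
qed

text \<open>
  If \<open>v \<le> g v\<close>, all positions below \<open>v\<close> lie left of \<open>v\<close>, so those not used by smaller values
  carry larger ones, which are then inverted with \<open>v\<close>.
\<close>

lemma placement_excedance:
  fixes g :: "nat \<Rightarrow> nat"
  assumes "finite E" "bij_betw g E D" "v \<in> E"
    and "card (left_larger E g v) + card {w \<in> E. w < v} < card {d \<in> D. d < v}"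
  shows "g v < v"
proof (rule ccontr)
  assume "\<not> g v < v"
  have "{d \<in> D. d < v} \<subseteq> g ` (left_larger E g v \<union> {w \<in> E. w < v})"
  proof
    fix d assume d: "d \<in> {d \<in> D. d < v}"
    then obtain w where w: "w \<in> E" "d = g w"
      using assms(2) by (auto simp: bij_betw_def)
    then have "w \<noteq> v"
      using d \<open>\<not> g v < v\<close> by auto
    then have "w \<in> left_larger E g v \<union> {w \<in> E. w < v}"
      using w d \<open>\<not> g v < v\<close> by (auto simp: left_larger_def)
    then show "d \<in> g ` (left_larger E g v \<union> {w \<in> E. w < v})"
      using w by blast
  qed
  moreover have fin: "finite (left_larger E g v \<union> {w \<in> E. w < v})"
    using assms(1) by (auto simp: left_larger_def)
  ultimately have "card {d \<in> D. d < v} \<le> card (left_larger E g v \<union> {w \<in> E. w < v})"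
    by (meson card_image_le card_mono finite_imageI order_trans)
  also have "\<dots> \<le> card (left_larger E g v) + card {w \<in> E. w < v}"
    by (rule card_Un_le)
  finally show False
    using assms(4) by simp
qed

lemma count_image_mset_set:
  assumes "finite A"
  shows "count (image_mset f (mset_set A)) v = card {x \<in> A. f x = v}"
proof -
  have "count (image_mset f (mset_set A)) v = (\<Sum>x\<in>{x \<in> A. v = f x}. 1)"
    using assms by (subst count_image_mset') (auto intro!: sum.cong)
  also have "{x \<in> A. v = f x} = {x \<in> A. f x = v}"
    by auto
  finally show ?thesis
    by simp
qed

lemma count_inversion_bottoms:
  assumes D: "finite D" "dom \<sigma> = D" "bij_betw (\<lambda>i. the (\<sigma> i)) D E"
  shows "count (inversion_bottoms \<sigma>) v =
    (if v \<in> E then card (left_larger E (inv_into D (\<lambda>i. the (\<sigma> i))) v) else 0)"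
proof -
  let ?s = "\<lambda>i. the (\<sigma> i)"
  let ?g = "inv_into D ?s"
  define I where "I = {(i, j). i \<in> D \<and> j \<in> D \<and> i < j \<and> ?s i > ?s j}"
  have "I \<subseteq> D \<times> D"
    by (auto simp: I_def)
  then have "finite I"
    using D(1) by (meson finite_SigmaI finite_subset)
  have inj: "inj_on ?s D" and im: "?s ` D = E"
    using D(3) by (auto simp: bij_betw_def)
  have g: "?g w \<in> D" "?s (?g w) = w" if "w \<in> E" for w
    using inv_into_into[of w ?s D] f_inv_into_f[of w ?s D] im that by (metis, metis)
  have count: "count (inversion_bottoms \<sigma>) v = card {x \<in> I. ?s (snd x) = v}"
    unfolding inversion_bottoms_def D(2) I_def[symmetric] case_prod_beta
    by (rule count_image_mset_set) fact
  show ?thesis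
  proof (cases "v \<in> E")
    case True
    have "{x \<in> I. ?s (snd x) = v} = (\<lambda>w. (?g w, ?g v)) ` left_larger E ?g v"
    proof (intro equalityI subsetI)
      fix x assume "x \<in> {x \<in> I. ?s (snd x) = v}"
      moreover obtain i j where x: "x = (i, j)"
        by (rule prod.exhaust)
      ultimately have ij: "i \<in> D" "j \<in> D" "i < j" "v < ?s i" "?s j = v"
        unfolding I_def by simp_all
      then have "?g v = j" "?g (?s i) = i"
        using inv_into_f_f[OF inj ij(1)] inv_into_f_f[OF inj ij(2)] by metis+
      moreover have "?s i \<in> E"
        using im ij(1) by blast
      ultimately have "x = (?g (?s i), ?g v)" "?s i \<in> left_larger E ?g v"
        using x ij(3,4) unfolding left_larger_def by simp_all
      then show "x \<in> (\<lambda>w. (?g w, ?g v)) ` left_larger E ?g v"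
        by blast
    next
      fix x assume "x \<in> (\<lambda>w. (?g w, ?g v)) ` left_larger E ?g v"
      then obtain w where "w \<in> E" "v < w" "?g w < ?g v" "x = (?g w, ?g v)"
        by (auto simp: left_larger_def)
      then show "x \<in> {x \<in> I. ?s (snd x) = v}"
        using g[of w] g[OF True] unfolding I_def by simp
    qed
    moreover have "inj_on (\<lambda>w. (?g w, ?g v)) (left_larger E ?g v)"
    proof (rule inj_onI)
      fix w w' assume w: "w \<in> left_larger E ?g v" "w' \<in> left_larger E ?g v"
        "(?g w, ?g v) = (?g w', ?g v)"
      then have "w \<in> E" "w' \<in> E" "?g w = ?g w'"
        unfolding left_larger_def by blast+
      then show "w = w'"
        using g(2) by metis
    qed
    ultimately have "card {x \<in> I. ?s (snd x) = v} = card (left_larger E ?g v)"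
      by (simp only: card_image)
    then show ?thesis
      using True count by presburger
  next
    case False
    moreover have "?s (snd x) \<in> E" if "x \<in> I" for x
      using that \<open>I \<subseteq> D \<times> D\<close> im by (metis imageI mem_Sigma_iff prod.collapse subsetD)
    ultimately have "{x \<in> I. ?s (snd x) = v} = {}"
      by blast
    then show ?thesis
      using False count by (simp only: card.empty if_False)
  qed
qed

text \<open>
  The defining property of \<^term>\<open>chi_e n \<pi>\<close>, with the run tops, the run bottoms and the
  descent views replaced by arbitrary data.
\<close>

definition has_inversion_bottoms ::
    "nat set \<Rightarrow> nat set \<Rightarrow> nat multiset \<Rightarrow> (nat \<rightharpoonup> nat) \<Rightarrow> bool" where
  "has_inversion_bottoms D E V \<sigma> \<longleftrightarrow>
     dom \<sigma> = D \<and> bij_betw (\<lambda>i. the (\<sigma> i)) D E \<and> inversion_bottoms \<sigma> = V"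

lemma has_inversion_bottoms_unique:
  assumes "finite D" "has_inversion_bottoms D E V \<sigma>" "has_inversion_bottoms D E V \<sigma>'"
  shows "\<sigma> = \<sigma>'"
proof -
  let ?g = "inv_into D (\<lambda>i. the (\<sigma> i))" and ?g' = "inv_into D (\<lambda>i. the (\<sigma>' i))"
  note d = assms(2,3)[unfolded has_inversion_bottoms_def]
  have bij: "bij_betw ?g E D" "bij_betw ?g' E D"
    using d by (auto intro: bij_betw_inv_into)
  have "finite E"
    using bij_betw_finite[of _ D E] d assms(1) by blast
  moreover have "card (left_larger E ?g v) = card (left_larger E ?g' v)" if "v \<in> E" for v
    using that d count_inversion_bottoms[OF assms(1), of \<sigma> E v]
      count_inversion_bottoms[OF assms(1), of \<sigma>' E v] by auto
  ultimately have eq: "?g v = ?g' v" if "v \<in> E" for v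
    using placement_unique[OF _ bij] that by blast
  show ?thesis
  proof
    fix i
    show "\<sigma> i = \<sigma>' i"
    proof (cases "i \<in> D")
      case True
      then have E: "the (\<sigma> i) \<in> E"
        using d by (auto simp: bij_betw_def)
      have "?g (the (\<sigma> i)) = i"
        using d True by (metis bij_betw_def inv_into_f_f)
      then have "?g' (the (\<sigma> i)) = i"
        using eq[OF E] by simp
      then have "the (\<sigma>' i) = the (\<sigma> i)"
        using d E by (metis bij_betw_def f_inv_into_f)
      then show ?thesis
        using d True by (metis domD option.sel)
    next
      case False
      then show ?thesis
        using d by (metis domIff)
    qed
  qed
qed

lemma has_inversion_bottoms_exists:
  fixes D E :: "nat set"
  assumes "finite D" "finite E" "card D = card E" "set_mset V \<subseteq> E"
    and "\<And>v. v \<in> E \<Longrightarrow> count V v < card {w \<in> E. v \<le> w}"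
  shows "\<exists>\<sigma>. has_inversion_bottoms D E V \<sigma>"
proof -
  obtain g where g: "bij_betw g E D" "\<And>v. v \<in> E \<Longrightarrow> card (left_larger E g v) = count V v"
    using placement_exists[OF assms(1-3), of "count V"] assms(5) by blast
  define \<sigma> where "\<sigma> = (\<lambda>i. if i \<in> D then Some (inv_into E g i) else None)"
  have dom: "dom \<sigma> = D"
    by (auto simp: \<sigma>_def split: if_splits)
  have "bij_betw (inv_into E g) D E"
    using g(1) by (rule bij_betw_inv_into)
  then have bij: "bij_betw (\<lambda>i. the (\<sigma> i)) D E"
    by (rule bij_betw_cong[THEN iffD1, rotated]) (auto simp: \<sigma>_def)
  let ?h = "inv_into D (\<lambda>i. the (\<sigma> i))"
  have h: "?h w = g w" if "w \<in> E" for w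
  proof -
    have "g w \<in> D" "the (\<sigma> (g w)) = w"
      using that g(1) by (auto simp: \<sigma>_def bij_betw_def inv_into_f_f)
    then show ?thesis
      using bij by (metis bij_betw_def inv_into_f_f)
  qed
  have "inversion_bottoms \<sigma> = V"
  proof (rule multiset_eqI)
    fix v
    have "left_larger E ?h v = left_larger E g v" if "v \<in> E"
      using h that by (auto simp: left_larger_def)
    moreover have "count V v = 0" if "v \<notin> E"
      using that assms(4) by (meson not_in_iff subsetD)
    ultimately show "count (inversion_bottoms \<sigma>) v = count V v"
      using count_inversion_bottoms[OF assms(1) dom bij, of v] g(2) by auto
  qed
  then show ?thesis
    using dom bij by (auto simp: has_inversion_bottoms_def)
qed

lemma has_inversion_bottoms_excedance:
  fixes D E :: "nat set"
  assumes "finite D" "has_inversion_bottoms D E V \<sigma>"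
    and "\<And>v. v \<in> E \<Longrightarrow> count V v + card {w \<in> E. w < v} < card {d \<in> D. d < v}"
    and "\<sigma> i = Some v"
  shows "i < v"
proof -
  let ?g = "inv_into D (\<lambda>i. the (\<sigma> i))"
  have dom: "dom \<sigma> = D" and bij: "bij_betw (\<lambda>i. the (\<sigma> i)) D E"
    and V: "inversion_bottoms \<sigma> = V"
    using assms(2) by (auto simp: has_inversion_bottoms_def)
  have "i \<in> D"
    using assms(4) dom by blast
  then have "?g v = i"
    using assms(4) bij inv_into_f_f[of "\<lambda>i. the (\<sigma> i)" D i] by (simp add: bij_betw_def)
  moreover have "v \<in> E"
    using \<open>i \<in> D\<close> assms(4) bij by (metis bij_betwE option.sel)
  moreover have "finite E"
    using bij assms(1) bij_betw_finite by blast
  ultimately show ?thesis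
    using placement_excedance[OF _ bij_betw_inv_into[OF bij], of v] assms(3)[of v]
      count_inversion_bottoms[OF assms(1) dom bij, of v] V by simp
qed

section \<open>Runs and the pairs of adjacent letters\<close>

lemma dec_runs_Cons_ex: "\<exists>r rs. dec_runs (x # xs) = (x # r) # rs"
  by (induction xs arbitrary: x) (use list.sel in \<open>fastforce split: if_splits\<close>)+

lemma dec_runs_nonempty: "r \<in> set (dec_runs xs) \<Longrightarrow> r \<noteq> []"
proof (induction xs arbitrary: r rule: dec_runs.induct)
  case (3 x y ys)
  obtain r' rs where "dec_runs (y # ys) = (y # r') # rs"
    using dec_runs_Cons_ex by blast
  then show ?case
    using 3 by (auto split: if_splits)
qed auto

lemma concat_dec_runs: "concat (dec_runs xs) = xs"
proof (induction xs rule: dec_runs.induct)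
  case (3 x y ys)
  obtain r' rs where "dec_runs (y # ys) = (y # r') # rs"
    using dec_runs_Cons_ex by blast
  then show ?case
    using 3 by (auto split: if_splits)
qed auto

lemma sorted_wrt_dec_runs: "r \<in> set (dec_runs xs) \<Longrightarrow> sorted_wrt (>) r"
proof (induction xs arbitrary: r rule: dec_runs.induct)
  case (3 x y ys)
  obtain r' rs where "dec_runs (y # ys) = (y # r') # rs"
    using dec_runs_Cons_ex by blast
  then show ?case
    using 3 by (fastforce split: if_splits)
qed auto

lemma successively_dec_runs:
  "distinct xs \<Longrightarrow> successively (\<lambda>r r'. last r < hd r') (dec_runs xs)"
proof (induction xs rule: dec_runs.induct)
  case (3 x y ys)
  obtain r' rs where r: "dec_runs (y # ys) = (y # r') # rs"
    using dec_runs_Cons_ex by blast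
  have "successively (\<lambda>r r'. last r < hd r') (dec_runs (y # ys))"
    using 3 by (cases "x > y") auto
  moreover have "x < y" if "\<not> x > y"
  proof -
    have "x \<noteq> y"
      using "3.prems" by simp
    then show ?thesis
      using that by linarith
  qed
  ultimately show ?case
    using r by (auto simp: successively_Cons split: if_splits)
qed auto

definition adjacent :: "'a list \<Rightarrow> 'a \<Rightarrow> 'a \<Rightarrow> bool" where
  "adjacent xs x y \<longleftrightarrow> (\<exists>k. Suc k < length xs \<and> xs ! k = x \<and> xs ! Suc k = y)"

lemma adjacent_Nil [simp]: "\<not> adjacent [] x y"
  by (simp add: adjacent_def)

lemma adjacent_Cons:
  "adjacent (a # xs) x y \<longleftrightarrow> xs \<noteq> [] \<and> a = x \<and> hd xs = y \<or> adjacent xs x y"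
proof
  assume "adjacent (a # xs) x y"
  then obtain k where k: "Suc k < length (a # xs)" "(a # xs) ! k = x" "(a # xs) ! Suc k = y"
    by (auto simp: adjacent_def)
  then show "xs \<noteq> [] \<and> a = x \<and> hd xs = y \<or> adjacent xs x y"
    by (cases k) (auto simp: adjacent_def hd_conv_nth)
next
  assume "xs \<noteq> [] \<and> a = x \<and> hd xs = y \<or> adjacent xs x y"
  then show "adjacent (a # xs) x y"
  proof
    assume "xs \<noteq> [] \<and> a = x \<and> hd xs = y"
    then show ?thesis
      unfolding adjacent_def by (intro exI[of _ 0]) (auto simp: hd_conv_nth)
  next
    assume "adjacent xs x y"
    then obtain k where "Suc k < length xs" "xs ! k = x" "xs ! Suc k = y"
      by (auto simp: adjacent_def)
    then show ?thesis
      unfolding adjacent_def by (intro exI[of _ "Suc k"]) auto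
  qed
qed

lemma adjacent_in_set: "adjacent xs x y \<Longrightarrow> x \<in> set xs \<and> y \<in> set xs"
  by (auto simp: adjacent_def)

lemma adjacent_descent_iff:
  "adjacent xs x y \<and> x > y \<longleftrightarrow> (\<exists>r\<in>set (dec_runs xs). adjacent r x y)"
proof (induction xs rule: dec_runs.induct)
  case (3 a b ys)
  obtain r' rs where r: "dec_runs (b # ys) = (b # r') # rs"
    using dec_runs_Cons_ex by blast
  have "adjacent (b # ys) x y \<and> x > y \<longleftrightarrow> (\<exists>r\<in>set (dec_runs (b # ys)). adjacent r x y)"
    using 3 by (cases "a > b") auto
  then show ?case
    using r by (auto simp: adjacent_Cons)
qed (auto simp: adjacent_Cons)

lemma adjacent_crossing_exists:
  fixes v :: "'a::linorder"
  assumes "sorted_wrt (>) r" "r \<noteq> []" "v < hd r" "last r < v" "v \<notin> set r"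
  shows "\<exists>x y. adjacent r x y \<and> v < x \<and> y < v"
  using assms
proof (induction r)
  case (Cons a r)
  then have "r \<noteq> []"
    by auto
  show ?case
  proof (cases "v < hd r")
    case True
    then show ?thesis
      using Cons \<open>r \<noteq> []\<close> by (auto simp: adjacent_Cons)
  next
    case False
    then have "hd r < v"
      using Cons.prems(5) \<open>r \<noteq> []\<close> by (metis hd_in_set list.set_intros(2) not_less_iff_gr_or_eq)
    then show ?thesis
      using Cons.prems \<open>r \<noteq> []\<close> by (auto simp: adjacent_Cons)
  qed
qed simp

lemma adjacent_crossing_unique:
  fixes v :: "'a::linorder"
  assumes "sorted_wrt (>) r" "adjacent r x y" "v < x" "y < v" "adjacent r x' y'" "v < x'" "y' < v"
  shows "x = x'"
  using assms
proof (induction r)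
  case (Cons a r)
  have below: "z \<le> hd r" if "z \<in> set r" for z
    using that Cons.prems(1) by (cases r) auto
  have "\<not> adjacent r z w" if "hd r < v" "v < z" for z w
    using below[of z] that adjacent_in_set[of r z w] by auto
  then show ?case
    using Cons by (auto simp: adjacent_Cons)
qed simp

section \<open>Partitions labelled by their block minima\<close>

text \<open>
  A set of runs is encoded by the map \<open>base\<close> that sends each letter to the bottom of its run.
\<close>

locale bottom_map =
  fixes n :: nat and base :: "nat \<Rightarrow> nat"
  assumes base_pos: "v \<in> {1..n} \<Longrightarrow> 1 \<le> base v"
    and base_le: "v \<in> {1..n} \<Longrightarrow> base v \<le> v"
    and base_idem: "v \<in> {1..n} \<Longrightarrow> base (base v) = base v"

definition block_tops :: "nat \<Rightarrow> (nat \<Rightarrow> nat) \<Rightarrow> nat set" where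
  "block_tops n base = {v \<in> {1..n}. \<forall>w\<in>{1..n}. base w = base v \<longrightarrow> w \<le> v}"

text \<open>
  The runs, given by their bottoms, that pass \<open>v\<close> from above to below and have a smaller
  bottom than the run of \<open>v\<close>. Each of them has exactly one descent enclosing \<open>v\<close>.
\<close>

definition crossing :: "nat \<Rightarrow> (nat \<Rightarrow> nat) \<Rightarrow> nat \<Rightarrow> nat set" where
  "crossing n base v =
     {b \<in> base ` {1..n}. b < v \<and> b < base v \<and> (\<exists>w\<in>{1..n}. v < w \<and> base w = b)}"

definition open_below :: "nat \<Rightarrow> (nat \<Rightarrow> nat) \<Rightarrow> nat \<Rightarrow> nat set" where
  "open_below n base v =
     {b \<in> base ` {1..n}. b < v \<and> \<not> (\<exists>t\<in>block_tops n base. t < v \<and> base t = b)}"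

context bottom_map
begin

lemma base_in: "v \<in> {1..n} \<Longrightarrow> base v \<in> {1..n}"
  using base_pos[of v] base_le[of v] by auto

lemma bottoms_subset: "base ` {1..n} \<subseteq> {1..n}"
  using base_in by blast

lemma bottom_iff: "v \<in> {1..n} \<Longrightarrow> v \<in> base ` {1..n} \<longleftrightarrow> base v = v"
  using base_idem by (metis imageE image_eqI)

lemma block_top_exists:
  assumes "b \<in> base ` {1..n}"
  shows "\<exists>t\<in>block_tops n base. base t = b"
proof -
  let ?B = "{w \<in> {1..n}. base w = b}"
  have B: "finite ?B" "?B \<noteq> {}"
    using assms by auto
  define t where "t = Max ?B"
  have "t \<in> ?B" "\<And>w. w \<in> ?B \<Longrightarrow> w \<le> t"
    using Max_in[OF B] Max_ge[OF B(1)] unfolding t_def by blast+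
  then show ?thesis
    unfolding block_tops_def by (intro bexI[of _ t]) auto
qed

lemma inj_on_block_tops: "inj_on base (block_tops n base)"
  by (auto simp: inj_on_def block_tops_def intro: antisym)

lemma base_block_tops: "base ` block_tops n base = base ` {1..n}"
proof
  show "base ` block_tops n base \<subseteq> base ` {1..n}"
    by (auto simp: block_tops_def)
  show "base ` {1..n} \<subseteq> base ` block_tops n base"
    using block_top_exists by (metis imageI subsetI)
qed

lemma card_block_tops: "card (block_tops n base) = card (base ` {1..n})"
  using card_image[OF inj_on_block_tops] by (simp add: base_block_tops)

lemma base_open_below:
  assumes "v \<in> {1..n} - base ` {1..n}"
  shows "base v \<in> open_below n base v"
proof -
  have "base v \<noteq> v"
    using assms bottom_iff by auto
  then have "base v < v"
    using base_le[of v] assms by auto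
  then show ?thesis
    using assms unfolding open_below_def block_tops_def by force
qed

text \<open>
  The run of \<open>v\<close> is thus the one in position \<open>card (crossing n base v)\<close> of the open runs,
  ordered by their bottoms. Whether a run is open at \<open>v\<close> only depends on the tops and on
  the letters below \<open>v\<close>.
\<close>

lemma crossing_eq_open_below:
  assumes "v \<in> {1..n} - base ` {1..n}"
  shows "crossing n base v = {b \<in> open_below n base v. b < base v}"
proof (intro equalityI subsetI)
  fix b assume b: "b \<in> crossing n base v"
  then obtain w where w: "w \<in> {1..n}" "v < w" "base w = b"
    by (auto simp: crossing_def)
  have "\<not> (\<exists>t\<in>block_tops n base. t < v \<and> base t = b)"
    using w by (force simp: block_tops_def)
  then show "b \<in> {b \<in> open_below n base v. b < base v}"
    using b by (auto simp: crossing_def open_below_def)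
next
  fix b assume b: "b \<in> {b \<in> open_below n base v. b < base v}"
  then obtain t where t: "t \<in> block_tops n base" "base t = b"
    using block_top_exists by (force simp: open_below_def)
  then have "\<not> t < v" "t \<noteq> v"
    using b by (auto simp: open_below_def)
  then show "b \<in> crossing n base v"
    using b t unfolding crossing_def open_below_def block_tops_def
    by (auto intro!: bexI[of _ t])
qed

lemma finite_open_below: "finite (open_below n base v)"
  by (auto simp: open_below_def)

text \<open>
  A run contributes its bottom but not its top to the letters below \<open>v\<close> exactly if it is open
  at \<open>v\<close>. So the open runs make up the surplus of the letters below \<open>v\<close> that are not tops over
  those that are not bottoms.
\<close>

lemma card_open_below:
  assumes "v \<in> {1..n}"
  shows "card (open_below n base v) + card {w \<in> {1..n} - base ` {1..n}. w < v} =
    card {d \<in> {1..n} - block_tops n base. d < v}"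
proof -
  let ?B = "{b \<in> base ` {1..n}. b < v}" and ?T = "{t \<in> block_tops n base. t < v}"
  have tops: "block_tops n base \<subseteq> {1..n}"
    by (auto simp: block_tops_def)
  have "finite ?T"
    using finite_subset[OF tops] by simp
  have "base ` ?T \<subseteq> ?B"
  proof
    fix b assume "b \<in> base ` ?T"
    then obtain t where t: "t \<in> {1..n}" "t < v" "b = base t"
      using tops by blast
    then have "b < v"
      using base_le[of t] by simp
    then show "b \<in> ?B"
      using t by blast
  qed
  moreover have "open_below n base v = ?B - base ` ?T"
    unfolding open_below_def by blast
  moreover have "card (base ` ?T) = card ?T"
    by (rule card_image, rule inj_on_subset[OF inj_on_block_tops]) auto
  ultimately have op: "card (open_below n base v) + card ?T = card ?B"
    using card_Diff_subset[of "base ` ?T" ?B] \<open>finite ?T\<close> card_mono[of ?B "base ` ?T"] by auto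
  have "card {w \<in> {1..n} - S. w < v} + card {s \<in> S. s < v} = card {1..<v}"
    if "S \<subseteq> {1..n}" for S
  proof -
    have "{w \<in> {1..n} - S. w < v} \<union> {s \<in> S. s < v} = {1..<v}"
      using that assms by auto
    moreover have "finite {s \<in> S. s < v}"
      by simp
    moreover have "{w \<in> {1..n} - S. w < v} \<inter> {s \<in> S. s < v} = {}"
      by blast
    ultimately show ?thesis
      using card_Un_disjoint[of "{w \<in> {1..n} - S. w < v}" "{s \<in> S. s < v}"] by simp
  qed
  from this[OF tops] this[OF bottoms_subset] show ?thesis
    using op by linarith
qed

text \<open>
  The run of \<open>v\<close> is open at \<open>v\<close> without crossing \<open>v\<close>. The resulting strict inequality is what
  forces every value of \<^term>\<open>chi_e n \<pi>\<close> to be an excedance.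
\<close>

lemma card_crossing_excess:
  assumes "v \<in> {1..n} - base ` {1..n}"
  shows "card (crossing n base v) + card {w \<in> {1..n} - base ` {1..n}. w < v} <
    card {d \<in> {1..n} - block_tops n base. d < v}"
proof -
  have "crossing n base v \<subset> open_below n base v"
    using crossing_eq_open_below[OF assms] base_open_below[OF assms] by auto
  then have "card (crossing n base v) < card (open_below n base v)"
    using finite_open_below psubset_card_mono by blast
  then show ?thesis
    using card_open_below[of v] assms by simp
qed

text \<open>
  Every crossing run has a letter above \<open>v\<close>, which is not its bottom. So there are at most as many
  crossings as there are larger values that can be placed to the left of \<open>v\<close>.
\<close>

lemma card_crossing_less:
  assumes "v \<in> {1..n} - base ` {1..n}"
  shows "card (crossing n base v) < card {w \<in> {1..n} - base ` {1..n}. v \<le> w}"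
proof -
  let ?W = "{w \<in> {1..n} - base ` {1..n}. v < w}"
  have "crossing n base v \<subseteq> base ` ?W"
  proof
    fix b assume "b \<in> crossing n base v"
    then obtain w where w: "w \<in> {1..n}" "v < w" "base w = b" "b < v"
      by (auto simp: crossing_def)
    then have "base w \<noteq> w"
      by auto
    then have "w \<in> ?W"
      using w bottom_iff by auto
    then show "b \<in> base ` ?W"
      using w by blast
  qed
  moreover have "finite ?W"
    by simp
  ultimately have "card (crossing n base v) \<le> card ?W"
    by (rule surj_card_le[rotated])
  also have "card ?W < card {w \<in> {1..n} - base ` {1..n}. v \<le> w}"
    using assms by (intro psubset_card_mono) auto
  finally show ?thesis .
qed

end

text \<open>
  Reading the letters upwards, a run bottom opens a run, and every other letter goes to the
  open run whose rank is its number of crossings. Counting the runs by rank among those open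
  from below is what makes the reconstruction absolute; downwards, one would only learn the
  relative order of the bottoms that are still to come.
\<close>

lemma bottom_map_determined:
  assumes "bottom_map n base" "bottom_map n base'"
    and bottoms: "base ` {1..n} = base' ` {1..n}"
    and tops: "block_tops n base = block_tops n base'"
    and cross: "\<And>v. v \<in> {1..n} - base ` {1..n} \<Longrightarrow>
      card (crossing n base v) = card (crossing n base' v)"
    and "v \<in> {1..n}"
  shows "base v = base' v"
  using \<open>v \<in> {1..n}\<close>
proof (induction v rule: less_induct)
  case (less v)
  interpret B: bottom_map n base by fact
  interpret B': bottom_map n base' by fact
  show ?case
  proof (cases "v \<in> base ` {1..n}")
    case True
    then show ?thesis
      using B.bottom_iff B'.bottom_iff bottoms less.prems by metis
  next
    case False
    then have v: "v \<in> {1..n} - base ` {1..n}" "v \<in> {1..n} - base' ` {1..n}"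
      using less.prems bottoms by auto
    have "base t = base' t" if "t \<in> block_tops n base'" "t < v" for t
      using that less.IH by (auto simp: block_tops_def)
    then have op: "open_below n base v = open_below n base' v"
      unfolding open_below_def bottoms tops by auto
    have "base v \<in> open_below n base v" "base' v \<in> open_below n base v"
      using B.base_open_below[OF v(1)] B'.base_open_below[OF v(2)] op by auto
    moreover have "card {b \<in> open_below n base v. b < base v} =
        card {b \<in> open_below n base v. b < base' v}"
      using cross[OF v(1)] B.crossing_eq_open_below[OF v(1)] B'.crossing_eq_open_below[OF v(2)]
        op by simp
    ultimately show ?thesis
      by (rule rank_inject[OF B.finite_open_below])
  qed
qed

section \<open>Descent views and the runs of a permutation\<close>

definition bottom_of :: "nat \<Rightarrow> (nat \<Rightarrow> nat) \<Rightarrow> nat \<Rightarrow> nat" where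
  "bottom_of n \<pi> v = last (run_of n \<pi> v)"

abbreviation proper_views :: "nat \<Rightarrow> (nat \<Rightarrow> nat) \<Rightarrow> nat multiset" where
  "proper_views n \<pi> \<equiv> filter_mset (\<lambda>v. v \<notin> run_bottoms n \<pi>) (descent_views n \<pi>)"

lemma adjacent_one_line:
  "adjacent (one_line n \<pi>) x y \<longleftrightarrow> (\<exists>i\<in>{1..<n}. \<pi> i = x \<and> \<pi> (Suc i) = y)"
proof
  assume "adjacent (one_line n \<pi>) x y"
  then obtain k where "Suc k < n" "\<pi> (Suc k) = x" "\<pi> (Suc (Suc k)) = y"
    by (auto simp: adjacent_def one_line_def nth_append simp del: upt_Suc)
  then show "\<exists>i\<in>{1..<n}. \<pi> i = x \<and> \<pi> (Suc i) = y"
    by (intro bexI[of _ "Suc k"]) auto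
next
  assume "\<exists>i\<in>{1..<n}. \<pi> i = x \<and> \<pi> (Suc i) = y"
  then obtain i where "1 \<le> i" "i < n" "\<pi> i = x" "\<pi> (Suc i) = y"
    by auto
  then show "adjacent (one_line n \<pi>) x y"
    unfolding adjacent_def one_line_def
    by (intro exI[of _ "i - 1"]) (auto simp del: upt_Suc)
qed

locale permutation =
  fixes n :: nat and \<pi> :: "nat \<Rightarrow> nat"
  assumes permutes: "\<pi> permutes {1..n}"
begin

lemma set_one_line: "set (one_line n \<pi>) = {1..n}"
proof -
  have "set [1..<Suc n] = {1..n}"
    by (simp add: atLeastLessThanSuc_atLeastAtMost del: upt_Suc)
  then show ?thesis
    using permutes_image[OF permutes] by (simp add: one_line_def del: upt_Suc)
qed

lemma distinct_one_line: "distinct (one_line n \<pi>)"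
  using permutes_inj[OF permutes]
  by (auto simp: one_line_def distinct_map inj_on_def inj_def simp del: upt_Suc)

lemma concat_runs: "concat (runs n \<pi>) = one_line n \<pi>"
  by (simp add: runs_def concat_dec_runs)

lemma run_nonempty: "r \<in> set (runs n \<pi>) \<Longrightarrow> r \<noteq> []"
  by (simp add: runs_def dec_runs_nonempty)

lemma distinct_concat_runs: "distinct (concat (runs n \<pi>))"
  using distinct_one_line by (simp add: concat_runs)

lemma sorted_run: "r \<in> set (runs n \<pi>) \<Longrightarrow> sorted_wrt (>) r"
  by (simp add: runs_def sorted_wrt_dec_runs)

lemma distinct_runs: "distinct (runs n \<pi>)"
proof -
  have "[] \<notin> set (runs n \<pi>)"
    using run_nonempty by blast
  then show ?thesis
    using distinct_concat_runs by (simp add: distinct_concat_iff removeAll_id)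
qed

lemma run_eqI:
  assumes "r \<in> set (runs n \<pi>)" "r' \<in> set (runs n \<pi>)" "v \<in> set r" "v \<in> set r'"
  shows "r = r'"
  using distinct_concat_runs assms by (auto simp: distinct_concat_iff)

lemma run_of_eq: "r \<in> set (runs n \<pi>) \<Longrightarrow> v \<in> set r \<Longrightarrow> run_of n \<pi> v = r"
  unfolding run_of_def using run_eqI by blast

lemma run_exists: "v \<in> {1..n} \<Longrightarrow> \<exists>r\<in>set (runs n \<pi>). v \<in> set r"
  using set_one_line by (auto simp flip: concat_runs)

lemma run_subset: "r \<in> set (runs n \<pi>) \<Longrightarrow> v \<in> set r \<Longrightarrow> v \<in> {1..n}"
  using set_one_line by (auto simp flip: concat_runs)

lemma run_bounds:
  assumes "r \<in> set (runs n \<pi>)" "v \<in> set r"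
  shows "last r \<le> v" "v \<le> hd r"
proof -
  have "v \<noteq> last r \<Longrightarrow> last r < v"
    using assms(2) sorted_run[OF assms(1)]
    by (cases r rule: rev_cases) (auto simp: sorted_wrt_append)
  then show "last r \<le> v"
    by fastforce
  show "v \<le> hd r"
    using assms(2) sorted_run[OF assms(1)] by (cases r) auto
qed

lemma run_of_bottom_of:
  assumes "v \<in> {1..n}"
  shows "run_of n \<pi> v \<in> set (runs n \<pi>)" "v \<in> set (run_of n \<pi> v)"
  using run_exists[OF assms] run_of_eq by auto

lemma bottom_of_eq:
  assumes "r \<in> set (runs n \<pi>)" "v \<in> {1..n}"
  shows "bottom_of n \<pi> v = last r \<longleftrightarrow> v \<in> set r"
  using assms run_of_bottom_of[of v] run_of_eq run_eqI run_nonempty last_in_set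
  by (metis bottom_of_def)

sublocale bottom_map n "bottom_of n \<pi>"
proof
  fix v assume v: "v \<in> {1..n}"
  note r = run_of_bottom_of[OF v]
  have l: "last (run_of n \<pi> v) \<in> set (run_of n \<pi> v)"
    using run_nonempty[OF r(1)] by simp
  show "1 \<le> bottom_of n \<pi> v"
    using run_subset[OF r(1) l] by (simp add: bottom_of_def)
  show "bottom_of n \<pi> v \<le> v"
    using run_bounds[OF r] by (simp add: bottom_of_def)
  show "bottom_of n \<pi> (bottom_of n \<pi> v) = bottom_of n \<pi> v"
    using run_of_eq[OF r(1) l] by (simp add: bottom_of_def)
qed

lemma run_bottoms_eq: "run_bottoms n \<pi> = bottom_of n \<pi> ` {1..n}"
proof
  show "run_bottoms n \<pi> \<subseteq> bottom_of n \<pi> ` {1..n}"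
  proof
    fix b assume "b \<in> run_bottoms n \<pi>"
    then obtain r where r: "r \<in> set (runs n \<pi>)" "b = last r"
      by (auto simp: run_bottoms_def)
    then have "b \<in> set r"
      using run_nonempty by simp
    then have "b \<in> {1..n}" "bottom_of n \<pi> b = b"
      using r run_subset bottom_of_eq[OF r(1)] by auto
    then show "b \<in> bottom_of n \<pi> ` {1..n}"
      by (metis imageI)
  qed
  show "bottom_of n \<pi> ` {1..n} \<subseteq> run_bottoms n \<pi>"
    using run_of_bottom_of(1) by (auto simp: run_bottoms_def bottom_of_def)
qed

lemma run_tops_eq: "run_tops n \<pi> = block_tops n (bottom_of n \<pi>)"
proof (intro equalityI subsetI)
  fix t assume "t \<in> run_tops n \<pi>"
  then obtain r where r: "r \<in> set (runs n \<pi>)" "t = hd r"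
    by (auto simp: run_tops_def)
  then have "t \<in> set r"
    using run_nonempty by simp
  moreover have "t \<in> {1..n}"
    using r \<open>t \<in> set r\<close> run_subset by blast
  ultimately have "bottom_of n \<pi> t = last r"
    using bottom_of_eq[OF r(1)] by simp
  moreover have "w \<le> t" if "w \<in> {1..n}" "bottom_of n \<pi> w = last r" for w
    using that bottom_of_eq[OF r(1)] run_bounds(2)[OF r(1)] r(2) by simp
  ultimately show "t \<in> block_tops n (bottom_of n \<pi>)"
    using \<open>t \<in> {1..n}\<close> by (simp add: block_tops_def)
next
  fix t assume t: "t \<in> block_tops n (bottom_of n \<pi>)"
  define r where "r = run_of n \<pi> t"
  have t': "t \<in> {1..n}"
    using t by (simp add: block_tops_def)
  have r: "r \<in> set (runs n \<pi>)" "t \<in> set r"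
    using run_of_bottom_of[OF t'] by (auto simp: r_def)
  then have h: "hd r \<in> set r"
    using run_nonempty by simp
  then have "hd r \<in> {1..n}"
    using r(1) run_subset by blast
  moreover from this have "bottom_of n \<pi> (hd r) = bottom_of n \<pi> t"
    using bottom_of_eq[OF r(1)] h r(2) t' by metis
  ultimately have "hd r \<le> t"
    using t by (simp add: block_tops_def)
  then have "hd r = t"
    using run_bounds(2)[OF r] by simp
  then show "t \<in> run_tops n \<pi>"
    using r(1) by (auto simp: run_tops_def)
qed

lemma run_eq_sorted_block:
  assumes "r \<in> set (runs n \<pi>)"
  shows "r = rev (sorted_list_of_set {v \<in> {1..n}. bottom_of n \<pi> v = last r})"
proof -
  have "{v \<in> {1..n}. bottom_of n \<pi> v = last r} = set (rev r)"
    using bottom_of_eq[OF assms] run_subset[OF assms] by auto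
  moreover have "sorted (rev r)" "distinct (rev r)"
    using sorted_run[OF assms] sorted_wrt_rev[of "(\<le>)" r]
      sorted_wrt_mono_rel[of r "(>)" "\<lambda>x y. y \<le> x"] strict_sorted_iff[of "rev r"]
      sorted_wrt_rev[of "(<)" r] by auto
  ultimately have "sorted_list_of_set {v \<in> {1..n}. bottom_of n \<pi> v = last r} = rev r"
    by (metis sorted_list_of_set.idem_if_sorted_distinct)
  then show ?thesis
    by simp
qed

lemma set_runs_eq:
  "set (runs n \<pi>) =
     (\<lambda>b. rev (sorted_list_of_set {v \<in> {1..n}. bottom_of n \<pi> v = b})) ` (bottom_of n \<pi> ` {1..n})"
proof -
  have "set (runs n \<pi>) =
      (\<lambda>r. rev (sorted_list_of_set {v \<in> {1..n}. bottom_of n \<pi> v = last r})) ` set (runs n \<pi>)"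
    using image_cong[OF refl, of "set (runs n \<pi>)" "\<lambda>r. r"] run_eq_sorted_block by simp
  then show ?thesis
    unfolding run_bottoms_eq[symmetric] run_bottoms_def image_image by simp
qed

text \<open>
  A descent \<open>\<pi>(i) > v > \<pi>(i+1)\<close> is counted through the bottom of the run that contains it: a
  decreasing sequence passes \<open>v\<close> only once.
\<close>

lemma count_descent_views:
  assumes v: "v \<in> {1..n}"
  shows "count (descent_views n \<pi>) v = card (crossing n (bottom_of n \<pi>) v)"
proof -
  let ?base = "bottom_of n \<pi>"
  define A where "A = {(i, j). i \<in> {1..<n} \<and> j \<in> {1..n} \<and> \<pi> i > \<pi> j \<and> \<pi> j > \<pi> (Suc i) \<and>
    last (run_of n \<pi> (\<pi> i)) < last (run_of n \<pi> (\<pi> j))}"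
  have "A \<subseteq> {1..<n} \<times> {1..n}"
    by (auto simp: A_def)
  then have "finite A"
    by (rule finite_subset) simp
  then have count: "count (descent_views n \<pi>) v = card {x \<in> A. \<pi> (snd x) = v}"
    unfolding descent_views_def A_def[symmetric] case_prod_beta by (rule count_image_mset_set)
  have run: "\<exists>r\<in>set (runs n \<pi>). adjacent r (\<pi> i) (\<pi> (Suc i))"
    if "i \<in> {1..<n}" "\<pi> i > \<pi> (Suc i)" for i
    using that adjacent_descent_iff[of "one_line n \<pi>"] adjacent_one_line[of n \<pi>]
    unfolding runs_def by metis
  have in_n: "\<pi> i \<in> {1..n}" if "i \<in> {1..n}" for i
    using permutes that by (meson permutes_in_image)
  let ?f = "\<lambda>x. ?base (\<pi> (fst x))"
  have "bij_betw ?f {x \<in> A. \<pi> (snd x) = v} (crossing n ?base v)"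
    unfolding bij_betw_def
  proof (intro conjI equalityI subsetI inj_onI)
    fix x x' assume x: "x \<in> {x \<in> A. \<pi> (snd x) = v}" and x': "x' \<in> {x \<in> A. \<pi> (snd x) = v}"
      and eq: "?f x = ?f x'"
    obtain i j i' j' where ij: "x = (i, j)" "x' = (i', j')"
      by (metis surj_pair)
    have i: "i \<in> {1..<n}" "\<pi> j = v" "\<pi> i > v" "v > \<pi> (Suc i)"
      and i': "i' \<in> {1..<n}" "\<pi> j' = v" "\<pi> i' > v" "v > \<pi> (Suc i')"
      using x x' ij by (auto simp: A_def)
    obtain r r' where r: "r \<in> set (runs n \<pi>)" "adjacent r (\<pi> i) (\<pi> (Suc i))"
        and r': "r' \<in> set (runs n \<pi>)" "adjacent r' (\<pi> i') (\<pi> (Suc i'))"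
      using run[of i] run[of i'] i i' by auto
    have "\<pi> i \<in> set r" "\<pi> i' \<in> set r'" "\<pi> i' \<in> {1..n}"
      using adjacent_in_set[OF r(2)] adjacent_in_set[OF r'(2)] in_n[of i'] i'(1) by simp_all
    moreover have "last r = last r'"
      using eq ij run_of_eq[OF r(1)] run_of_eq[OF r'(1)] calculation by (simp add: bottom_of_def)
    ultimately have "r = r'"
      using bottom_of_eq[OF r(1)] bottom_of_eq[OF r'(1)] run_eqI[OF r(1) r'(1)] by metis
    then have "\<pi> i = \<pi> i'"
      using adjacent_crossing_unique[OF sorted_run[OF r(1)] r(2) i(3,4) _ i'(3,4)] r' by simp
    then show "x = x'"
      using ij i(2) i'(2) permutes_inj[OF permutes] by (metis injD)
  next
    fix b assume "b \<in> ?f ` {x \<in> A. \<pi> (snd x) = v}"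
    then obtain i j where i: "b = ?base (\<pi> i)" "i \<in> {1..<n}" "\<pi> j = v" "\<pi> i > v" "v > \<pi> (Suc i)"
        "?base (\<pi> i) < ?base v"
      by (auto simp: A_def bottom_of_def)
    obtain r where r: "r \<in> set (runs n \<pi>)" "adjacent r (\<pi> i) (\<pi> (Suc i))"
      using run[of i] i by auto
    have mem: "\<pi> i \<in> set r" "\<pi> (Suc i) \<in> set r" "\<pi> i \<in> {1..n}"
      using adjacent_in_set[OF r(2)] in_n[of i] i(2) by simp_all
    then have "b = last r"
      using i(1) bottom_of_eq[OF r(1)] by simp
    then have "b < v"
      using run_bounds(1)[OF r(1) mem(2)] i by simp
    then show "b \<in> crossing n ?base v"
      using i mem unfolding crossing_def by auto
  next
    fix b assume b: "b \<in> crossing n ?base v"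
    then obtain w where w: "w \<in> {1..n}" "v < w" "?base w = b" "b < v" "b < ?base v"
      by (auto simp: crossing_def)
    define r where "r = run_of n \<pi> w"
    have r: "r \<in> set (runs n \<pi>)" "w \<in> set r" "last r = b"
      using run_of_bottom_of[OF w(1)] w(3) by (auto simp: r_def bottom_of_def)
    have "v \<notin> set r"
      using bottom_of_eq[OF r(1) v] w r by auto
    moreover have "v < hd r"
      using run_bounds(2)[OF r(1,2)] w by simp
    ultimately obtain x y where xy: "adjacent r x y" "v < x" "y < v"
      using adjacent_crossing_exists[OF sorted_run[OF r(1)] run_nonempty[OF r(1)], of v] r w
      by auto
    then have "adjacent (one_line n \<pi>) x y"
      using adjacent_descent_iff[of "one_line n \<pi>" x y] r(1) by (auto simp: runs_def)
    then obtain i where i: "i \<in> {1..<n}" "\<pi> i = x" "\<pi> (Suc i) = y"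
      by (auto simp: adjacent_one_line)
    obtain j where j: "j \<in> {1..n}" "\<pi> j = v"
      using v permutes_image[OF permutes] by (metis imageE)
    have "?base x = b"
      using run_of_eq[OF r(1)] adjacent_in_set[OF xy(1)] r(3) by (simp add: bottom_of_def)
    then have "(i, j) \<in> A"
      using i j xy w by (auto simp: A_def bottom_of_def)
    then show "b \<in> ?f ` {x \<in> A. \<pi> (snd x) = v}"
      using i j \<open>?base x = b\<close> by (intro image_eqI[of _ _ "(i, j)"]) auto
  qed
  then show ?thesis
    unfolding count by (rule bij_betw_same_card)
qed

lemma count_proper_views:
  assumes "v \<in> {1..n} - run_bottoms n \<pi>"
  shows "count (proper_views n \<pi>) v = card (crossing n (bottom_of n \<pi>) v)"
  using assms count_descent_views by simp

lemma has_inversion_bottoms_chi_e: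
  "has_inversion_bottoms ({1..n} - run_tops n \<pi>) ({1..n} - run_bottoms n \<pi>) (proper_views n \<pi>)
     (chi_e n \<pi>)"
proof -
  let ?D = "{1..n} - run_tops n \<pi>" and ?E = "{1..n} - run_bottoms n \<pi>"
  have "card ?D = card ?E"
  proof -
    have "run_tops n \<pi> \<subseteq> {1..n}"
      by (auto simp: run_tops_eq block_tops_def)
    then have "card ?D = card {1..n} - card (run_tops n \<pi>)"
      by (meson card_Diff_subset finite_atLeastAtMost finite_subset)
    moreover have "run_bottoms n \<pi> \<subseteq> {1..n}"
      using bottoms_subset run_bottoms_eq by simp
    then have "card ?E = card {1..n} - card (run_bottoms n \<pi>)"
      by (meson card_Diff_subset finite_atLeastAtMost finite_subset)
    ultimately show ?thesis
      using card_block_tops run_tops_eq run_bottoms_eq by simp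
  qed
  moreover have "set_mset (proper_views n \<pi>) \<subseteq> ?E"
  proof -
    have fin: "finite {(i, j). i \<in> {1..<n} \<and> j \<in> {1..n} \<and> \<pi> i > \<pi> j \<and> \<pi> j > \<pi> (Suc i) \<and>
        last (run_of n \<pi> (\<pi> i)) < last (run_of n \<pi> (\<pi> j))}"
      by (rule finite_subset[of _ "{1..<n} \<times> {1..n}"]) auto
    have "set_mset (descent_views n \<pi>) \<subseteq> \<pi> ` {1..n}"
      using fin unfolding descent_views_def by auto
    then show ?thesis
      using permutes_image[OF permutes] by auto
  qed
  moreover have "count (proper_views n \<pi>) v < card {w \<in> ?E. v \<le> w}" if "v \<in> ?E" for v
    using card_crossing_less[of v] count_proper_views[OF that] that run_bottoms_eq by simp
  ultimately have "\<exists>\<sigma>. has_inversion_bottoms ?D ?E (proper_views n \<pi>) \<sigma>"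
    by (intro has_inversion_bottoms_exists) auto
  then have "\<exists>!\<sigma>. has_inversion_bottoms ?D ?E (proper_views n \<pi>) \<sigma>"
    using has_inversion_bottoms_unique[of ?D ?E "proper_views n \<pi>"] by blast
  then show ?thesis
    unfolding chi_e_def has_inversion_bottoms_def by (rule theI')
qed

lemma chi_e_excedance:
  assumes "chi_e n \<pi> i = Some v"
  shows "i < v"
proof (rule has_inversion_bottoms_excedance[OF _ has_inversion_bottoms_chi_e])
  show "chi_e n \<pi> i = Some v"
    by fact
  fix v assume "v \<in> {1..n} - run_bottoms n \<pi>"
  then show "count (proper_views n \<pi>) v + card {w \<in> {1..n} - run_bottoms n \<pi>. w < v} <
      card {d \<in> {1..n} - run_tops n \<pi>. d < v}"
    using card_crossing_excess[of v] count_proper_views[of v]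
    by (simp add: run_tops_eq run_bottoms_eq)
qed simp

end

section \<open>Iterating an injective partial map\<close>

lemma map_pow_add: "map_pow f j x = Some y \<Longrightarrow> map_pow f (i + j) x = map_pow f i y"
  by (induction i) (auto simp: map_comp_def)

lemma map_pow_split:
  "map_pow f (i + j) x = Some z \<Longrightarrow> \<exists>y. map_pow f j x = Some y \<and> map_pow f i y = Some z"
  by (induction i arbitrary: z) (auto simp: map_comp_Some_iff)

lemma map_pow_inject:
  assumes "inj_on f (dom f)"
  shows "map_pow f k x = Some z \<Longrightarrow> map_pow f k y = Some z \<Longrightarrow> x = y"
proof (induction k arbitrary: z)
  case (Suc k)
  then obtain u w where "map_pow f k x = Some u" "f u = Some z" "map_pow f k y = Some w" "f w = Some z"
    by (auto simp: map_comp_Some_iff)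
  moreover from this have "u = w"
    using assms by (metis domI inj_onD)
  ultimately show ?case
    using Suc.IH by blast
qed simp

lemma map_pow_in_ran: "map_pow f k x = Some z \<Longrightarrow> 0 < k \<Longrightarrow> z \<in> ran f"
  by (cases k) (auto simp: map_comp_Some_iff intro: ranI)

lemma map_pow_in_dom: "map_pow f k x = Some z \<Longrightarrow> 0 < k \<Longrightarrow> x \<in> dom f"
  using map_pow_split[of f "k - 1" 1 x z] by (auto simp: map_comp_Some_iff)

lemma path_start_exists:
  assumes "finite (dom f)" "inj_on f (dom f)" "c \<notin> dom f"
  shows "\<exists>s k. s \<notin> ran f \<and> map_pow f k s = Some c"
  using assms
proof (induction "card (dom f)" arbitrary: f c rule: less_induct)
  case less
  show ?case
  proof (cases "c \<in> ran f")
    case False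
    then show ?thesis
      by (intro exI[of _ c] exI[of _ 0]) simp
  next
    case True
    then obtain y where y: "f y = Some c"
      by (auto simp: ran_def)
    \<comment> \<open>Without its last edge, the path into \<open>c\<close> is a path ending in \<open>y\<close>.\<close>
    define g where "g = f(y := None)"
    have dom: "dom g = dom f - {y}" and sub: "g z = Some w \<Longrightarrow> f z = Some w" for z w
      by (auto simp: g_def split: if_splits)
    have "card (dom g) < card (dom f)"
      using less.prems(1) y unfolding dom by (intro card_Diff1_less) auto
    moreover have "inj_on g (dom g)"
      using less.prems(2) unfolding dom by (auto simp: g_def inj_on_def)
    ultimately obtain s k where s: "s \<notin> ran g" "map_pow g k s = Some y"
      using less.hyps[of g y] less.prems(1) dom by auto
    have "map_pow f j s = Some z" if "map_pow g j s = Some z" for j z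
      using that sub by (induction j arbitrary: z) (auto simp: map_comp_Some_iff)
    then have "map_pow f (Suc k) s = Some c"
      using s(2) y by (auto simp: map_comp_Some_iff)
    moreover have "s \<notin> ran f"
    proof
      assume "s \<in> ran f"
      then obtain z where z: "f z = Some s"
        by (auto simp: ran_def)
      then have "z = y"
        using s(1) by (auto simp: g_def ran_def split: if_splits)
      then have "s = c"
        using z y by simp
      then have "k = 0"
        using map_pow_in_dom[OF s(2)] less.prems(3) dom by auto
      then show False
        using s(2) \<open>s = c\<close> y less.prems(3) by auto
    qed
    ultimately show ?thesis
      by blast
  qed
qed

lemma iter_preimage_eqI:
  assumes "inj_on f (dom f)" "s \<notin> ran f" "map_pow f k s = Some c"
  shows "iter_preimage f c = s"
proof -
  have max: "j \<le> k" if j: "map_pow f j x = Some c" for j x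
  proof (rule ccontr)
    assume "\<not> j \<le> k"
    then obtain y where y: "map_pow f (j - k) x = Some y" "map_pow f k y = Some c"
      using map_pow_split[of f k "j - k" x c] j by auto
    then have "y = s"
      using map_pow_inject[OF assms(1)] assms(3) by blast
    then show False
      using map_pow_in_ran[OF y(1)] assms(2) \<open>\<not> j \<le> k\<close> by simp
  qed
  show ?thesis
    unfolding iter_preimage_def
  proof (rule the_equality)
    show "\<exists>k. map_pow f k s = Some c \<and> (\<forall>k' s'. map_pow f k' s' = Some c \<longrightarrow> k' \<le> k)"
      using assms(3) max by blast
    fix s'
    assume "\<exists>k. map_pow f k s' = Some c \<and> (\<forall>k' s'. map_pow f k' s' = Some c \<longrightarrow> k' \<le> k)"
    then obtain j where "map_pow f j s' = Some c" "k \<le> j"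
      using assms(3) by blast
    then show "s' = s"
      using max map_pow_inject[OF assms(1)] assms(3) by (metis le_antisym)
  qed
qed

text \<open>
  With \<open>f = \<tau>\<close>, this is the rule by which the loop chooses the value \<open>x\<close> of a run top \<open>t\<close> whose
  run is preceded by a run with bottom \<open>a\<close>.
\<close>

definition first_below :: "('a::linorder \<rightharpoonup> 'a) \<Rightarrow> 'a \<Rightarrow> 'a \<Rightarrow> 'a \<Rightarrow> bool" where
  "first_below f t a x \<longleftrightarrow> (\<exists>k\<ge>1. map_pow f k a = Some x \<and> x < t \<and>
     (\<forall>j y. 1 \<le> j \<and> j < k \<and> map_pow f j a = Some y \<longrightarrow> t \<le> y))"

lemma first_below_Least:
  assumes "first_below f t a x"
  shows "map_pow f (LEAST k. k \<ge> 1 \<and> (\<exists>x. map_pow f k a = Some x \<and> x < t)) a = Some x"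
proof -
  obtain k where k: "k \<ge> 1" "map_pow f k a = Some x" "x < t"
      "\<And>j y. 1 \<le> j \<Longrightarrow> j < k \<Longrightarrow> map_pow f j a = Some y \<Longrightarrow> t \<le> y"
    using assms by (auto simp: first_below_def)
  have "(LEAST k. k \<ge> 1 \<and> (\<exists>x. map_pow f k a = Some x \<and> x < t)) = k"
    using k by (intro Least_equality) (auto simp: not_less[symmetric] dest: leD)
  then show ?thesis
    using k by simp
qed

text \<open>
  If the iteration stayed at or above \<open>t\<close>, it would never leave the domain of \<open>f\<close>, hence by
  injectivity it would come back to its starting point \<open>a\<close>, which lies below \<open>t\<close>.
\<close>

lemma first_below_exists:
  assumes "inj_on f (dom f)" "finite (dom f)" "a \<in> dom f" "a < t"
    and "\<And>x. x \<in> ran f \<Longrightarrow> t \<le> x \<Longrightarrow> x \<in> dom f"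
  shows "\<exists>x. first_below f t a x"
proof -
  have "\<exists>k\<ge>1. \<exists>x. map_pow f k a = Some x \<and> x < t"
  proof (rule ccontr)
    assume "\<not> ?thesis"
    then have high: "t \<le> x" if "map_pow f k a = Some x" "k \<ge> 1" for k x
      using that by (meson not_le)
    have total: "\<exists>x\<in>dom f. map_pow f k a = Some x" for k
    proof (induction k)
      case (Suc k)
      then obtain x y where "map_pow f (Suc k) a = Some y" "f x = Some y"
        by auto
      moreover from this have "y \<in> dom f"
        using high[of "Suc k" y] assms(5)[of y] by (auto intro: ranI)
      ultimately show ?case
        by blast
    qed (use assms(3) in simp)
    define p where "p k = the (map_pow f k a)" for k
    have p: "map_pow f k a = Some (p k)" "p k \<in> dom f" for k
      using total[of k] by (auto simp: p_def)
    have "\<not> inj p"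
    proof
      assume "inj p"
      moreover have "range p \<subseteq> dom f"
        using p(2) by blast
      then have "finite (range p)"
        using assms(2) finite_subset by blast
      ultimately show False
        using finite_imageD infinite_UNIV_nat by blast
    qed
    then obtain i j where ij: "i < j" "p i = p j"
      unfolding inj_def by (metis nat_neq_iff)
    then obtain y where y: "map_pow f (j - i) a = Some y" "map_pow f i y = Some (p j)"
      using map_pow_split[of f i "j - i" a "p j"] p(1)[of j] by auto
    then have "y = a"
      using map_pow_inject[OF assms(1) y(2), of a] p(1)[of i] ij by simp
    moreover have "1 \<le> j - i"
      using ij(1) by linarith
    ultimately show False
      using high[OF y(1)] assms(4) by simp
  qed
  then have "\<exists>k. k \<ge> 1 \<and> (\<exists>x. map_pow f k a = Some x \<and> x < t)"
    by blast
  then obtain k where k: "k \<ge> 1 \<and> (\<exists>x. map_pow f k a = Some x \<and> x < t)"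
      "\<And>j. j < k \<Longrightarrow> \<not> (j \<ge> 1 \<and> (\<exists>x. map_pow f j a = Some x \<and> x < t))"
    using exists_least_iff[of "\<lambda>k. k \<ge> 1 \<and> (\<exists>x. map_pow f k a = Some x \<and> x < t)"] by blast
  then show ?thesis
    unfolding first_below_def by (meson not_le)
qed

text \<open>
  Following \<open>f\<close> backwards from \<open>x\<close>, the starting point is the first value below \<open>t\<close>.
\<close>

lemma first_below_inject:
  assumes "inj_on f (dom f)" "a < t" "a' < t" "first_below f t a x" "first_below f t a' x"
  shows "a = a'"
proof -
  have *: "b = b'" if b: "b < t" and k: "1 \<le> k" "k \<le> k'"
    and pow: "map_pow f k b = Some x" "map_pow f k' b' = Some x"
    and first: "\<And>j y. 1 \<le> j \<Longrightarrow> j < k' \<Longrightarrow> map_pow f j b' = Some y \<Longrightarrow> t \<le> y" for b b' k k'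
  proof -
    obtain y where y: "map_pow f (k' - k) b' = Some y" "map_pow f k y = Some x"
      using map_pow_split[of f k "k' - k" b' x] pow(2) k by auto
    then have "y = b"
      using map_pow_inject[OF assms(1)] pow(1) by blast
    then have "k' - k = 0"
      using first[of "k' - k" y] y(1) b k by (metis diff_less le_less_trans less_one
          linorder_not_less not_le order_less_le_trans zero_less_one)
    then show ?thesis
      using y(1) \<open>y = b\<close> by simp
  qed
  obtain k where k: "k \<ge> 1" "map_pow f k a = Some x"
      "\<And>j y. 1 \<le> j \<Longrightarrow> j < k \<Longrightarrow> map_pow f j a = Some y \<Longrightarrow> t \<le> y"
    using assms(4) by (auto simp: first_below_def)
  obtain k' where k': "k' \<ge> 1" "map_pow f k' a' = Some x"
      "\<And>j y. 1 \<le> j \<Longrightarrow> j < k' \<Longrightarrow> map_pow f j a' = Some y \<Longrightarrow> t \<le> y"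
    using assms(5) by (auto simp: first_below_def)
  show ?thesis
  proof (cases "k \<le> k'")
    case True
    show ?thesis
      by (rule *[OF assms(2) k(1) True k(2) k'(2,3)])
  next
    case False
    then have "k' \<le> k"
      by simp
    show ?thesis
      by (rule sym, rule *[OF assms(3) k'(1) \<open>k' \<le> k\<close> k'(2) k(2,3)])
  qed
qed

section \<open>The invariant of the loop\<close>

text \<open>
  The last two conditions say that each step only alters what lies below the remaining run
  tops: the non-excedances are all below them, and from the smallest of them upwards the
  letters that are not yet values of \<open>\<sigma>\<close> are exactly the bottoms of the remaining runs.
  Below that, a remaining bottom may already be a value, and a removed one may be available.
\<close>

locale loop_state =
  fixes n :: nat and \<rho> :: "nat \<Rightarrow> nat" and rs :: "nat list list" and \<sigma> :: "nat \<rightharpoonup> nat"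
  assumes run: "r \<in> set rs \<Longrightarrow>
      last r \<in> {1..n} \<and> hd r \<in> {1..n} \<and> last r \<le> hd r \<and> \<rho> (last r) = hd r"
    and distinct_tops: "distinct (map hd rs)"
    and ascending: "successively (\<lambda>r r'. last r < hd r') rs"
    and dom_eq: "dom \<sigma> = {1..n} - hd ` set rs"
    and ran_subset: "ran \<sigma> \<subseteq> {1..n}"
    and inj: "inj_on \<sigma> (dom \<sigma>)"
    and nonexcedance: "r \<in> set rs \<Longrightarrow> \<sigma> y = Some z \<Longrightarrow> z \<le> y \<Longrightarrow> y < hd r"
    and free: "r \<in> set rs \<Longrightarrow> v \<in> {1..n} \<Longrightarrow> hd r \<le> v \<Longrightarrow> v \<notin> ran \<sigma> \<longleftrightarrow> v \<in> last ` set rs"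
begin

lemma run_eqI: "r \<in> set rs \<Longrightarrow> r' \<in> set rs \<Longrightarrow> hd r = hd r' \<Longrightarrow> r = r'"
  using distinct_tops by (simp add: distinct_map inj_on_def)

lemma run_eqI_last: "r \<in> set rs \<Longrightarrow> r' \<in> set rs \<Longrightarrow> last r = last r' \<Longrightarrow> r = r'"
  using run_eqI run by metis

lemma distinct_runs: "distinct rs"
  using distinct_tops by (simp add: distinct_map)

lemma path_start:
  assumes "r \<in> set rs"
  obtains k where "map_pow \<sigma> k (iter_preimage \<sigma> (hd r)) = Some (hd r)"
    "iter_preimage \<sigma> (hd r) \<notin> ran \<sigma>"
proof -
  have "finite (dom \<sigma>)" "hd r \<notin> dom \<sigma>"
    using assms by (auto simp: dom_eq)
  then obtain s k where "s \<notin> ran \<sigma>" "map_pow \<sigma> k s = Some (hd r)"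
    using path_start_exists[OF _ inj] by blast
  then show thesis
    using that iter_preimage_eqI[OF inj] by metis
qed

text \<open>
  Starting above a remaining top \<open>t\<close>, one only meets excedances and cannot come down to \<open>t\<close>.
\<close>

lemma path_start_le:
  assumes "r \<in> set rs"
  shows "iter_preimage \<sigma> (hd r) \<le> hd r"
proof (rule ccontr)
  let ?s = "iter_preimage \<sigma> (hd r)"
  assume "\<not> ?s \<le> hd r"
  then have "hd r < ?s"
    by simp
  have "hd r < z" if "map_pow \<sigma> k ?s = Some z" for k z
    using that
  proof (induction k arbitrary: z)
    case (Suc k)
    then obtain y where y: "map_pow \<sigma> k ?s = Some y" "\<sigma> y = Some z"
      by (auto simp: map_comp_Some_iff)
    then have "hd r < y"
      using Suc.IH by blast
    then have "y < z"
      using nonexcedance[OF assms y(2)] by force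
    then show ?case
      using \<open>hd r < y\<close> by simp
  qed (use \<open>hd r < ?s\<close> in simp)
  then show False
    using path_start[OF assms] by blast
qed

lemma path_start_in:
  assumes "r \<in> set rs"
  shows "iter_preimage \<sigma> (hd r) \<in> {1..n}"
proof -
  obtain k where "map_pow \<sigma> k (iter_preimage \<sigma> (hd r)) = Some (hd r)"
    using path_start[OF assms] .
  then have "iter_preimage \<sigma> (hd r) \<in> insert (hd r) (dom \<sigma>)"
    using map_pow_in_dom[of \<sigma> k] by (cases k) auto
  then show ?thesis
    using run[OF assms] dom_eq by auto
qed

lemma path_start_inject:
  assumes "r \<in> set rs" "r' \<in> set rs" "iter_preimage \<sigma> (hd r) = iter_preimage \<sigma> (hd r')"
  shows "r = r'"
proof -
  have *: "hd q = hd q'" if "q \<in> set rs" "k \<le> k'" "map_pow \<sigma> k s = Some (hd q)"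
      "map_pow \<sigma> k' s = Some (hd q')" for q q' k k' s
  proof -
    have "map_pow \<sigma> (k' - k) (hd q) = Some (hd q')"
      using map_pow_add[OF that(3), of "k' - k"] that by simp
    moreover have "hd q \<notin> dom \<sigma>"
      using that by (simp add: dom_eq)
    ultimately have "k' - k = 0"
      using map_pow_in_dom by (metis gr_zeroI)
    then show ?thesis
      using \<open>map_pow \<sigma> (k' - k) (hd q) = _\<close> by simp
  qed
  obtain k k' where "map_pow \<sigma> k (iter_preimage \<sigma> (hd r)) = Some (hd r)"
      "map_pow \<sigma> k' (iter_preimage \<sigma> (hd r)) = Some (hd r')"
    using path_start[OF assms(1)] path_start[OF assms(2)] assms(3) by metis
  then have "hd r = hd r'"
    using *[OF assms(1), of k k'] *[OF assms(2), of k' k] by (metis nat_le_linear)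
  then show ?thesis
    using run_eqI assms by blast
qed

abbreviation \<tau> :: "nat \<rightharpoonup> nat" where
  "\<tau> \<equiv> chi_tau \<rho> rs \<sigma>"

lemma dom_tau: "dom \<tau> = last ` set rs"
  by (auto simp: chi_tau_def split: if_splits)

lemma tau_last: "r \<in> set rs \<Longrightarrow> \<tau> (last r) = Some (iter_preimage \<sigma> (hd r))"
  using run by (simp add: chi_tau_def)

lemma inj_tau: "inj_on \<tau> (dom \<tau>)"
proof (rule inj_onI)
  fix b b' assume b: "b \<in> dom \<tau>" "b' \<in> dom \<tau>" "\<tau> b = \<tau> b'"
  then obtain r r' where r: "r \<in> set rs" "b = last r" "r' \<in> set rs" "b' = last r'"
    unfolding dom_tau by blast
  then have "iter_preimage \<sigma> (hd r) = iter_preimage \<sigma> (hd r')"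
    using b(3) tau_last by simp
  then show "b = b'"
    using path_start_inject[OF r(1,3)] r(2,4) by simp
qed

lemma ran_tau:
  assumes "x \<in> ran \<tau>"
  shows "x \<in> {1..n}" "x \<notin> ran \<sigma>"
proof -
  obtain b where "\<tau> b = Some x"
    using assms by (auto simp: ran_def)
  moreover from this obtain r where r: "r \<in> set rs" "b = last r"
    using dom_tau by blast
  ultimately have "x = iter_preimage \<sigma> (hd r)"
    using tau_last by simp
  then show "x \<in> {1..n}" "x \<notin> ran \<sigma>"
    using path_start_in[OF r(1)] path_start[OF r(1)] by simp_all
qed

lemma position_eq:
  assumes "rs = us @ r # vs"
  shows "(THE p. p < length rs \<and> hd (rs ! p) = hd r) = length us"
proof (rule the_equality)
  show "length us < length rs \<and> hd (rs ! length us) = hd r"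
    using assms by simp
  fix p assume p: "p < length rs \<and> hd (rs ! p) = hd r"
  moreover have "length us < length rs" "rs ! length us = r"
    using assms by simp_all
  ultimately have "map hd rs ! p = map hd rs ! length us"
    by (simp only: nth_map)
  then show "p = length us"
    using p distinct_tops assms by (subst (asm) nth_eq_iff_index_eq) auto
qed

lemma value_first:
  assumes "rs = r # vs"
  shows "chi_value \<rho> rs \<sigma> (hd r) = Some (iter_preimage \<sigma> (hd r))"
  using position_eq[of "[]" r vs] assms by (simp add: chi_value_def)

text \<open>
  Here the bottom \<open>a\<close> left of \<open>t\<close> is below \<open>t\<close>. This is why the minimal exponent exists,
  and also why \<open>a\<close> can be recovered from the resulting value.
\<close>

lemma value_later:
  assumes "rs = us @ q # r # vs"
  shows "\<exists>x. chi_value \<rho> rs \<sigma> (hd r) = Some x \<and> first_below \<tau> (hd r) (last q) x"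
    "last q < hd r"
proof -
  show less: "last q < hd r"
    using ascending by (simp add: assms successively_append_iff successively_Cons)
  have r: "r \<in> set rs" "q \<in> set rs"
    using assms by auto
  have "x \<in> dom \<tau>" if "x \<in> ran \<tau>" "hd r \<le> x" for x
    using free[OF r(1)] ran_tau[OF that(1)] that(2) dom_tau by blast
  then obtain x where x: "first_below \<tau> (hd r) (last q) x"
    using first_below_exists[OF inj_tau _ _ less] dom_tau r(2) by auto
  have "(THE p. p < length rs \<and> hd (rs ! p) = hd r) = Suc (length us)"
    using position_eq[of "us @ [q]" r vs] assms by simp
  moreover have "rs ! length us = q"
    using assms by simp
  ultimately have "chi_value \<rho> rs \<sigma> (hd r) = Some x"
    using first_below_Least[OF x] by (simp add: chi_value_def)
  then show "\<exists>x. chi_value \<rho> rs \<sigma> (hd r) = Some x \<and> first_below \<tau> (hd r) (last q) x"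
    using x by blast
qed

lemma value_props:
  assumes "rs = us @ r # vs"
  obtains x where "chi_value \<rho> rs \<sigma> (hd r) = Some x" "x \<in> {1..n}" "x \<notin> ran \<sigma>" "x \<le> hd r"
proof (cases us rule: rev_cases)
  case Nil
  then have "rs = r # vs" "r \<in> set rs"
    using assms by auto
  then show thesis
    using that value_first path_start_in path_start_le path_start by metis
next
  case (snoc us' q)
  then obtain x where x: "chi_value \<rho> rs \<sigma> (hd r) = Some x" "first_below \<tau> (hd r) (last q) x"
    using value_later(1)[of us' q r vs] assms by auto
  then obtain k where "k \<ge> 1" "map_pow \<tau> k (last q) = Some x" "x < hd r"
    by (auto simp: first_below_def)
  then have "x \<in> ran \<tau>"
    using map_pow_in_ran[of \<tau> k] by simp
  then show thesis
    using that x(1) ran_tau \<open>x < hd r\<close> by simp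
qed

lemma step:
  assumes split: "rs = us @ r # vs" and least: "\<forall>r'\<in>set rs. hd r \<le> hd r'"
  shows "loop_state n \<rho> (us @ vs) (\<sigma>(hd r := chi_value \<rho> rs \<sigma> (hd r)))"
proof -
  obtain x where x: "chi_value \<rho> rs \<sigma> (hd r) = Some x" "x \<in> {1..n}" "x \<notin> ran \<sigma>" "x \<le> hd r"
    using value_props[OF split] .
  have r: "r \<in> set rs"
    using split by simp
  have rest: "set (us @ vs) = set rs - {r}"
    using distinct_runs split by auto
  have less: "hd r < hd q" if "q \<in> set (us @ vs)" for q
    using that bspec[OF least, of q] run_eqI[OF r, of q] unfolding rest by (simp add: less_le) metis
  have t: "hd r \<in> {1..n}" "hd r \<notin> dom \<sigma>"
    using run[OF r] r by (auto simp: dom_eq)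
  have ran: "ran (\<sigma>(hd r \<mapsto> x)) = insert x (ran \<sigma>)"
    using t(2) by (simp add: domIff)
  have "loop_state n \<rho> (us @ vs) (\<sigma>(hd r \<mapsto> x))"
  proof
    fix q assume q: "q \<in> set (us @ vs)"
    then have q': "q \<in> set rs"
      using rest by blast
    show "last q \<in> {1..n} \<and> hd q \<in> {1..n} \<and> last q \<le> hd q \<and> \<rho> (last q) = hd q"
      using run[OF q'] .
    show "y < hd q" if "(\<sigma>(hd r \<mapsto> x)) y = Some z" "z \<le> y" for y z
      using that less[OF q] nonexcedance[OF q'] by (auto split: if_splits)
    show "v \<notin> ran (\<sigma>(hd r \<mapsto> x)) \<longleftrightarrow> v \<in> last ` set (us @ vs)" if "v \<in> {1..n}" "hd q \<le> v" for v
    proof -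
      have "v \<noteq> x" "v \<noteq> last r"
        using that less[OF q] x(4) run[OF r] by auto
      then show ?thesis
        using free[OF q' that] unfolding rest ran by blast
    qed
  next
    show "distinct (map hd (us @ vs))"
      using distinct_tops split by auto
    show "successively (\<lambda>r r'. last r < hd r') (us @ vs)"
    proof -
      have "last (last us) < hd (hd vs)" if "us \<noteq> []" "vs \<noteq> []"
      proof -
        have "last (last us) < hd r"
          using ascending that(1) by (simp add: split successively_append_iff)
        also have "hd r < hd (hd vs)"
          using that(2) by (intro less) simp
        finally show ?thesis .
      qed
      then show ?thesis
        using ascending by (auto simp: split successively_append_iff successively_Cons)
    qed
    have "hd ` set rs = insert (hd r) (hd ` set (us @ vs))"
      using split by auto
    moreover have "hd r \<notin> hd ` set (us @ vs)"
      using less by force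
    ultimately show "dom (\<sigma>(hd r \<mapsto> x)) = {1..n} - hd ` set (us @ vs)"
      using t(1) by (auto simp: dom_eq)
    show "ran (\<sigma>(hd r \<mapsto> x)) \<subseteq> {1..n}"
      unfolding ran using ran_subset x(2) by simp
    show "inj_on (\<sigma>(hd r \<mapsto> x)) (dom (\<sigma>(hd r \<mapsto> x)))"
      using inj x(3) t(2) by (auto simp: inj_on_def ran_def)
  qed
  then show ?thesis
    using x(1) by simp
qed

lemma loop_unfold:
  assumes "rs \<noteq> []"
  obtains us r vs where "rs = us @ r # vs" "\<forall>r'\<in>set rs. hd r \<le> hd r'"
    "chi_loop \<rho> rs \<sigma> = chi_loop \<rho> (us @ vs) (\<sigma>(hd r := chi_value \<rho> rs \<sigma> (hd r)))"
proof -
  define t where "t = Min (hd ` set rs)"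
  have "t \<in> hd ` set rs"
    using assms unfolding t_def by (intro Min_in) auto
  then obtain r where r: "r \<in> set rs" "hd r = t"
    by auto
  then obtain us vs where split: "rs = us @ r # vs"
    using split_list by metis
  have "t \<le> hd r'" if "r' \<in> set rs" for r'
    unfolding t_def using that by (intro Min_le) auto
  moreover have "filter (\<lambda>r'. hd r' \<noteq> t) rs = us @ vs"
  proof -
    have "t \<notin> hd ` (set us \<union> set vs)"
      using distinct_tops unfolding split r(2)[symmetric] by auto
    then have "filter (\<lambda>r'. hd r' \<noteq> t) us = us" "filter (\<lambda>r'. hd r' \<noteq> t) vs = vs"
      by (auto simp: filter_id_conv)
    then show ?thesis
      unfolding split by (simp add: r(2))
  qed
  ultimately show thesis
    using that[OF split] r(2) assms by (simp add: chi_loop.simps[of \<rho> rs] t_def[symmetric])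
qed

end

text \<open>
  At the end no run remains, so the domain is all of \<open>[n]\<close>. The values of the initial \<open>\<sigma>\<close> are
  never overwritten, which makes them visible in the result.
\<close>

lemma loop_result:
  assumes "loop_state n \<rho> rs \<sigma>"
  defines "f \<equiv> chi_loop \<rho> rs \<sigma>"
  shows "dom f = {1..n} \<and> ran f \<subseteq> {1..n} \<and> inj_on f {1..n} \<and>
    (\<forall>y\<in>dom \<sigma>. f y = \<sigma> y) \<and> (\<forall>r\<in>set rs. \<exists>z\<le>hd r. f (hd r) = Some z)"
  using assms(1) unfolding f_def
proof (induction "length rs" arbitrary: rs \<sigma>)
  case 0
  then interpret loop_state n \<rho> rs \<sigma>
    by simp
  have "rs = []"
    using 0 by simp
  then show ?case
    using dom_eq ran_subset inj[unfolded dom_eq] by (simp add: chi_loop.simps)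
next
  case (Suc m)
  interpret loop_state n \<rho> rs \<sigma>
    by (rule Suc.prems)
  have "rs \<noteq> []"
    using Suc.hyps(2) by auto
  obtain us r vs where rs: "rs = us @ r # vs" "\<forall>r'\<in>set rs. hd r \<le> hd r'"
    and loop: "chi_loop \<rho> rs \<sigma> = chi_loop \<rho> (us @ vs) (\<sigma>(hd r := chi_value \<rho> rs \<sigma> (hd r)))"
    using loop_unfold[OF \<open>rs \<noteq> []\<close>] .
  obtain x where x: "chi_value \<rho> rs \<sigma> (hd r) = Some x" "x \<le> hd r"
    using value_props[OF rs(1)] .
  let ?f = "chi_loop \<rho> rs \<sigma>"
  have "m = length (us @ vs)"
    using Suc.hyps(2) rs(1) by simp
  from Suc.hyps(1)[OF this step[OF rs]]
  have IH: "dom ?f = {1..n} \<and> ran ?f \<subseteq> {1..n} \<and> inj_on ?f {1..n} \<and>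
      (\<forall>y\<in>dom (\<sigma>(hd r \<mapsto> x)). ?f y = (\<sigma>(hd r \<mapsto> x)) y) \<and>
      (\<forall>r\<in>set (us @ vs). \<exists>z\<le>hd r. ?f (hd r) = Some z)"
    unfolding loop x(1) .
  have "hd r \<notin> dom \<sigma>"
    using rs(1) by (simp add: dom_eq)
  then have "?f y = \<sigma> y" if "y \<in> dom \<sigma>" for y
    using IH that by (metis domIff fun_upd_other insertCI dom_fun_upd option.discI)
  moreover have "?f (hd r) = Some x"
    using IH by simp
  then have "\<exists>z\<le>hd q. ?f (hd q) = Some z" if "q \<in> set rs" for q
    using IH that x(2) rs(1) by auto
  ultimately show ?case
    using IH by blast
qed

text \<open>
  Let \<open>b\<close> and \<open>t\<close> be the bottom and the top of the removed run. In first place it receives the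
  value \<open>\<tau>(b)\<close>. If \<open>b < t\<close>, going back along \<open>\<tau>\<close> from this value the first bottom below \<open>t\<close> is
  \<open>b\<close>, which does not lie left of its own run. If \<open>b = t\<close>, the value is \<open>t\<close>, whereas in any later
  place it is smaller than \<open>t\<close>.
\<close>

lemma value_first_ne_later:
  assumes "loop_state n \<rho> rs \<sigma>" "rs = r # vs"
    and "loop_state n \<rho> rs' \<sigma>" "rs' = us @ q # r # ws"
    and "set rs = set rs'"
  shows "chi_value \<rho> rs \<sigma> (hd r) \<noteq> chi_value \<rho> rs' \<sigma> (hd r)"
proof
  interpret A: loop_state n \<rho> rs \<sigma> by fact
  interpret B: loop_state n \<rho> rs' \<sigma> by fact
  assume eq: "chi_value \<rho> rs \<sigma> (hd r) = chi_value \<rho> rs' \<sigma> (hd r)"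
  define x where "x = iter_preimage \<sigma> (hd r)"
  have r: "r \<in> set rs'"
    using assms(4) by simp
  have later: "first_below B.\<tau> (hd r) (last q) x"
    using B.value_later(1)[OF assms(4)] A.value_first[OF assms(2)] eq by (auto simp: x_def)
  then have "x < hd r"
    by (auto simp: first_below_def)
  show False
  proof (cases "last r = hd r")
    case True
    then have "hd r \<notin> ran \<sigma>"
      using B.free[OF r, of "hd r"] B.run[OF r] r by (metis imageI order_refl)
    then have "x = hd r"
      unfolding x_def by (intro iter_preimage_eqI[OF B.inj, of _ 0]) auto
    then show False
      using \<open>x < hd r\<close> by simp
  next
    case False
    then have "last r < hd r"
      using B.run[OF r] by simp
    moreover have "first_below B.\<tau> (hd r) (last r) x"
      unfolding first_below_def using B.tau_last[OF r] \<open>x < hd r\<close>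
      by (intro exI[of _ 1]) (auto simp: x_def)
    ultimately have "last q = last r"
      using first_below_inject[OF B.inj_tau] B.value_later(2)[OF assms(4)] later by blast
    then have "q = r"
      using B.run_eqI_last[of q r] assms(4) by simp
    then show False
      using B.distinct_runs assms(4) by simp
  qed
qed

text \<open>
  By induction the sequences without the removed run agree. Its place in them is read off
  from \<open>\<sigma>(t)\<close>, and \<open>\<tau>\<close> is the same for both sequences since it only depends on the
  set of runs.
\<close>

lemma loop_inject:
  assumes "loop_state n \<rho> rs \<sigma>" "loop_state n \<rho> rs' \<sigma>" "set rs = set rs'"
    and "chi_loop \<rho> rs \<sigma> = chi_loop \<rho> rs' \<sigma>"
  shows "rs = rs'"
  using assms
proof (induction "length rs" arbitrary: rs rs' \<sigma>)
  case 0
  then show ?case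
    by simp
next
  case (Suc m)
  interpret A: loop_state n \<rho> rs \<sigma> by (rule Suc.prems)
  interpret B: loop_state n \<rho> rs' \<sigma> by (rule Suc.prems)
  have "rs \<noteq> []" "rs' \<noteq> []"
    using Suc.hyps(2) Suc.prems(3) by auto
  obtain us r vs where rs: "rs = us @ r # vs" "\<forall>q\<in>set rs. hd r \<le> hd q"
    and loop: "chi_loop \<rho> rs \<sigma> = chi_loop \<rho> (us @ vs) (\<sigma>(hd r := chi_value \<rho> rs \<sigma> (hd r)))"
    using A.loop_unfold[OF \<open>rs \<noteq> []\<close>] .
  obtain us' r' vs' where rs': "rs' = us' @ r' # vs'" "\<forall>q\<in>set rs'. hd r' \<le> hd q"
    and loop': "chi_loop \<rho> rs' \<sigma> = chi_loop \<rho> (us' @ vs') (\<sigma>(hd r' := chi_value \<rho> rs' \<sigma> (hd r')))"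
    using B.loop_unfold[OF \<open>rs' \<noteq> []\<close>] .
  have mem: "r \<in> set rs" "r' \<in> set rs"
    using rs(1) rs'(1) Suc.prems(3) by auto
  then have "hd r = hd r'"
    using rs(2) rs'(2) Suc.prems(3) by (simp add: antisym)
  then have [simp]: "r' = r"
    using A.run_eqI mem by simp
  note A' = A.step[OF rs] and B' = B.step[OF rs', simplified]
  have "chi_loop \<rho> rs \<sigma> (hd r) = chi_value \<rho> rs \<sigma> (hd r)"
  proof -
    obtain x where "chi_value \<rho> rs \<sigma> (hd r) = Some x"
      using A.value_props[OF rs(1)] .
    then show ?thesis
      using loop_result[OF A'] loop by simp
  qed
  moreover have "chi_loop \<rho> rs' \<sigma> (hd r) = chi_value \<rho> rs' \<sigma> (hd r)"
  proof -
    obtain x where "chi_value \<rho> rs' \<sigma> (hd r) = Some x"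
      using B.value_props[OF rs'(1)] by auto
    then show ?thesis
      using loop_result[OF B'] loop' by simp
  qed
  ultimately have eq: "chi_value \<rho> rs \<sigma> (hd r) = chi_value \<rho> rs' \<sigma> (hd r)"
    using Suc.prems(4) by simp
  have "set (us @ vs) = set rs - {r}" "set (us' @ vs') = set rs' - {r}"
    using A.distinct_runs B.distinct_runs rs(1) rs'(1) by auto
  then have rest: "us @ vs = us' @ vs'"
    using Suc.hyps Suc.prems(3,4) rs(1) loop loop' eq A' B' by (intro Suc.hyps(1)) auto
  show ?case
  proof (cases us rule: rev_cases)
    case us: Nil
    show ?thesis
    proof (cases us' rule: rev_cases)
      case Nil
      then show ?thesis
        using us rest rs(1) rs'(1) by simp
    next
      case (snoc ws q)
      then show ?thesis
        using value_first_ne_later[OF Suc.prems(1) _ Suc.prems(2) _ Suc.prems(3), of r vs ws q vs']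
          eq us rs(1) rs'(1) by simp
    qed
  next
    case us: (snoc ws q)
    show ?thesis
    proof (cases us' rule: rev_cases)
      case Nil
      then show ?thesis
        using value_first_ne_later[OF Suc.prems(2) _ Suc.prems(1) _ Suc.prems(3)[symmetric],
            of r vs' ws q vs] eq us rs(1) rs'(1) by simp
    next
      case (snoc ws' q')
      have split: "rs = ws @ q # r # vs" "rs' = ws' @ q' # r # vs'"
        using us snoc rs(1) rs'(1) by auto
      have tau: "A.\<tau> = B.\<tau>"
        using Suc.prems(3) by (simp add: chi_tau_def)
      obtain x where "first_below A.\<tau> (hd r) (last q) x" "first_below A.\<tau> (hd r) (last q') x"
        using A.value_later(1)[OF split(1)] B.value_later(1)[OF split(2)] eq tau by auto
      then have "last q = last q'"
        using first_below_inject[OF A.inj_tau] A.value_later(2)[OF split(1)]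
          B.value_later(2)[OF split(2)] by blast
      then have "q = q'"
        using A.run_eqI_last[of q q'] split Suc.prems(3) by auto
      moreover have "q \<notin> set ws" "q \<notin> set vs"
        using A.distinct_runs split(1) by auto
      ultimately show ?thesis
        using rest split us snoc by (simp add: append_Cons_eq_iff)
    qed
  qed
qed

section \<open>Injectivity\<close>

context permutation
begin

abbreviation final :: "nat \<rightharpoonup> nat" where
  "final \<equiv> chi_loop (run_rho n \<pi>) (runs n \<pi>) (chi_e n \<pi>)"

lemma dom_chi_e: "dom (chi_e n \<pi>) = {1..n} - run_tops n \<pi>"
  using has_inversion_bottoms_chi_e by (simp add: has_inversion_bottoms_def)

lemma ran_chi_e: "ran (chi_e n \<pi>) = {1..n} - run_bottoms n \<pi>"
proof -
  have "ran (chi_e n \<pi>) = (\<lambda>i. the (chi_e n \<pi> i)) ` dom (chi_e n \<pi>)"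
    by (force simp: ran_def dom_def image_def)
  then show ?thesis
    using has_inversion_bottoms_chi_e by (simp add: has_inversion_bottoms_def bij_betw_def)
qed

lemma run_bottoms_subset: "run_bottoms n \<pi> \<subseteq> {1..n}"
  using bottoms_subset by (simp add: run_bottoms_eq)

lemma loop_state_initial: "loop_state n (run_rho n \<pi>) (runs n \<pi>) (chi_e n \<pi>)"
proof
  fix r assume r: "r \<in> set (runs n \<pi>)"
  have ends: "hd r \<in> set r" "last r \<in> set r"
    using run_nonempty[OF r] by simp_all
  have "(THE r'. r' \<in> set (runs n \<pi>) \<and> last r' = last r) = r"
  proof (rule the_equality)
    fix r' assume "r' \<in> set (runs n \<pi>) \<and> last r' = last r"
    then show "r' = r"
      using run_eqI[of r' r "last r"] ends(2) r run_nonempty[of r'] last_in_set[of r'] by auto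
  qed (use r in simp)
  then show "last r \<in> {1..n} \<and> hd r \<in> {1..n} \<and> last r \<le> hd r \<and> run_rho n \<pi> (last r) = hd r"
    using run_subset[OF r] ends run_bounds(1)[OF r ends(1)] by (simp add: run_rho_def)
  show "y < hd r" if "chi_e n \<pi> y = Some z" "z \<le> y" for y z
    using chi_e_excedance[OF that(1)] that(2) by simp
  show "v \<notin> ran (chi_e n \<pi>) \<longleftrightarrow> v \<in> last ` set (runs n \<pi>)" if "v \<in> {1..n}" for v
    using that by (simp add: ran_chi_e run_bottoms_def)
next
  have "inj_on hd (set (runs n \<pi>))"
  proof (rule inj_onI)
    fix r r' assume "r \<in> set (runs n \<pi>)" "r' \<in> set (runs n \<pi>)" "hd r = hd r'"
    then show "r = r'"
      using run_eqI[of r r' "hd r"] run_nonempty hd_in_set by metis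
  qed
  then show "distinct (map hd (runs n \<pi>))"
    using distinct_runs by (simp add: distinct_map)
  show "successively (\<lambda>r r'. last r < hd r') (runs n \<pi>)"
    unfolding runs_def by (rule successively_dec_runs[OF distinct_one_line])
  show "dom (chi_e n \<pi>) = {1..n} - hd ` set (runs n \<pi>)"
    by (simp add: dom_chi_e run_tops_def)
  show "ran (chi_e n \<pi>) \<subseteq> {1..n}"
    by (simp add: ran_chi_e)
  show "inj_on (chi_e n \<pi>) (dom (chi_e n \<pi>))"
  proof (rule inj_onI)
    fix x y assume "x \<in> dom (chi_e n \<pi>)" "y \<in> dom (chi_e n \<pi>)" "chi_e n \<pi> x = chi_e n \<pi> y"
    then show "x = y"
      using has_inversion_bottoms_chi_e unfolding has_inversion_bottoms_def bij_betw_def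
      by (metis inj_onD)
  qed
qed

lemma final_eq: "final x = (if x \<in> {1..n} then Some (chi n \<pi> x) else None)"
proof (cases "x \<in> {1..n}")
  case True
  then have "x \<in> dom final"
    using loop_result[OF loop_state_initial] by simp
  then show ?thesis
    using True by (auto simp: chi_def)
next
  case False
  then have "x \<notin> dom final"
    using loop_result[OF loop_state_initial] by simp
  then show ?thesis
    using False by (auto simp: domIff)
qed

lemma chi_permutes: "chi n \<pi> permutes {1..n}"
proof (rule bij_imp_permutes)
  have inj: "inj_on (chi n \<pi>) {1..n}"
  proof (rule inj_onI)
    fix x y assume xy: "x \<in> {1..n}" "y \<in> {1..n}" "chi n \<pi> x = chi n \<pi> y"
    then have "final x = final y"
      by (simp add: final_eq)
    moreover have "inj_on final {1..n}"
      using loop_result[OF loop_state_initial] by simp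
    ultimately show "x = y"
      using xy(1,2) by (simp add: inj_on_eq_iff)
  qed
  moreover have "chi n \<pi> ` {1..n} \<subseteq> {1..n}"
  proof
    fix y assume "y \<in> chi n \<pi> ` {1..n}"
    then obtain x where "x \<in> {1..n}" "y = chi n \<pi> x"
      by blast
    then have "final x = Some y"
      by (simp add: final_eq)
    then have "y \<in> ran final"
      by (rule ranI)
    then show "y \<in> {1..n}"
      using loop_result[OF loop_state_initial] by blast
  qed
  ultimately show "bij_betw (chi n \<pi>) {1..n} {1..n}"
    by (simp add: bij_betw_def endo_inj_surj)
  show "chi n \<pi> x = x" if "x \<notin> {1..n}" for x
  proof -
    have "final x = None"
      using that by (simp only: final_eq if_False)
    then show ?thesis
      by (simp add: chi_def)
  qed
qed

text \<open>
  The values given by \<^term>\<open>chi_e n \<pi>\<close> are excedances, those added by the loop are not.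
\<close>

lemma run_tops_eq_nonexcedances: "run_tops n \<pi> = {x \<in> {1..n}. chi n \<pi> x \<le> x}"
  and chi_e_eq_excedances:
    "chi_e n \<pi> x = (if x \<in> {1..n} \<and> x < chi n \<pi> x then Some (chi n \<pi> x) else None)"
proof -
  have tops: "run_tops n \<pi> \<subseteq> {1..n}"
    by (auto simp: run_tops_eq block_tops_def)
  have top: "chi n \<pi> x \<le> x" if "x \<in> run_tops n \<pi>" for x
  proof -
    obtain r where "r \<in> set (runs n \<pi>)" "x = hd r"
      using \<open>x \<in> run_tops n \<pi>\<close> by (auto simp: run_tops_def)
    then have "\<exists>z\<le>x. final x = Some z"
      using loop_result[OF loop_state_initial] by blast
    then show ?thesis
      using tops \<open>x \<in> run_tops n \<pi>\<close> final_eq[of x] by auto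
  qed
  have nontop: "chi_e n \<pi> x = Some (chi n \<pi> x) \<and> x < chi n \<pi> x"
    if "x \<in> {1..n} - run_tops n \<pi>" for x
  proof -
    have "x \<in> dom (chi_e n \<pi>)"
      using that by (simp add: dom_chi_e)
    moreover from this have "final x = chi_e n \<pi> x"
      using loop_result[OF loop_state_initial] by blast
    ultimately have "chi_e n \<pi> x = Some (chi n \<pi> x)"
      using that final_eq[of x] by simp
    then show ?thesis
      using chi_e_excedance by blast
  qed
  show "run_tops n \<pi> = {x \<in> {1..n}. chi n \<pi> x \<le> x}"
    using tops top nontop by (fastforce simp: not_le[symmetric])
  show "chi_e n \<pi> x = (if x \<in> {1..n} \<and> x < chi n \<pi> x then Some (chi n \<pi> x) else None)"
  proof (cases "x \<in> {1..n} - run_tops n \<pi>")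
    case True
    then show ?thesis
      using nontop by simp
  next
    case False
    then have "chi_e n \<pi> x = None"
      using dom_chi_e by blast
    then show ?thesis
      using False top[of x] by auto
  qed
qed

end

lemma chi_inject:
  assumes "\<pi> permutes {1..n}" "\<pi>' permutes {1..n}" "chi n \<pi> = chi n \<pi>'"
  shows "\<pi> = \<pi>'"
proof -
  interpret A: permutation n \<pi> by unfold_locales fact
  interpret B: permutation n \<pi>' by unfold_locales fact
  have chi_e: "chi_e n \<pi> = chi_e n \<pi>'"
    using A.chi_e_eq_excedances B.chi_e_eq_excedances assms(3) by auto
  have tops: "run_tops n \<pi> = run_tops n \<pi>'"
    using A.run_tops_eq_nonexcedances B.run_tops_eq_nonexcedances assms(3) by simp
  have "run_bottoms n \<pi> = {1..n} - ran (chi_e n \<pi>)"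
    using A.run_bottoms_subset by (auto simp: A.ran_chi_e)
  also have "\<dots> = run_bottoms n \<pi>'"
    unfolding chi_e using B.run_bottoms_subset by (auto simp: B.ran_chi_e)
  finally have bottoms: "run_bottoms n \<pi> = run_bottoms n \<pi>'" .
  have views: "proper_views n \<pi> = proper_views n \<pi>'"
    using A.has_inversion_bottoms_chi_e B.has_inversion_bottoms_chi_e chi_e
    by (simp add: has_inversion_bottoms_def)
  have base: "bottom_of n \<pi> v = bottom_of n \<pi>' v" if "v \<in> {1..n}" for v
  proof (rule bottom_map_determined[OF A.bottom_map_axioms B.bottom_map_axioms])
    fix v assume "v \<in> {1..n} - bottom_of n \<pi> ` {1..n}"
    then have v: "v \<in> {1..n} - run_bottoms n \<pi>"
      by (simp add: A.run_bottoms_eq)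
    show "card (crossing n (bottom_of n \<pi>) v) = card (crossing n (bottom_of n \<pi>') v)"
      using A.count_proper_views[OF v] B.count_proper_views[OF v[unfolded bottoms]]
      unfolding views by (rule trans[OF sym])
  qed (use that bottoms tops in \<open>simp_all add: A.run_bottoms_eq B.run_bottoms_eq
      A.run_tops_eq B.run_tops_eq\<close>)
  have "bottom_of n \<pi> ` {1..n} = bottom_of n \<pi>' ` {1..n}"
    using bottoms by (simp add: A.run_bottoms_eq B.run_bottoms_eq)
  moreover have "{v \<in> {1..n}. bottom_of n \<pi> v = b} = {v \<in> {1..n}. bottom_of n \<pi>' v = b}" for b
    using base by auto
  ultimately have runs: "set (runs n \<pi>) = set (runs n \<pi>')"
    unfolding A.set_runs_eq B.set_runs_eq by simp
  then have rho: "run_rho n \<pi> = run_rho n \<pi>'"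
    by (simp add: run_rho_def fun_eq_iff)
  have "A.final = B.final"
    using A.final_eq B.final_eq assms(3) by auto
  then have "runs n \<pi> = runs n \<pi>'"
    using loop_inject[OF A.loop_state_initial] B.loop_state_initial runs rho chi_e by simp
  then have word: "one_line n \<pi> = one_line n \<pi>'"
    using A.concat_runs B.concat_runs by metis
  show ?thesis
  proof
    fix i
    show "\<pi> i = \<pi>' i"
    proof (cases "i \<in> {1..n}")
      case True
      then have "i \<in> set [1..<Suc n]"
        by auto
      then show ?thesis
        using word unfolding one_line_def by (simp only: map_eq_conv)
    next
      case False
      then show ?thesis
        using assms(1,2) by (simp add: permutes_not_in)
    qed
  qed
qed

theorem proposition4p4:
  fixes n :: nat
  assumes "n \<ge> 1"
  shows "inj_on (chi n) {\<pi>. \<pi> permutes {1..n}} \<and>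
    bij_betw (chi n) {\<pi>. \<pi> permutes {1..n}} {\<pi>. \<pi> permutes {1..n}}"
proof -
  let ?P = "{\<pi>. \<pi> permutes {1..n}}"
  have inj: "inj_on (chi n) ?P"
    using chi_inject by (auto intro: inj_onI)
  have "chi n ` ?P \<subseteq> ?P"
    using permutation.chi_permutes[OF permutation.intro] by auto
  moreover have "finite ?P"
    by (simp add: finite_permutations)
  ultimately have "chi n ` ?P = ?P"
    using inj by (simp add: endo_inj_surj)
  then show ?thesis
    using inj by (simp add: bij_betw_def)
qed

end
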